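(* Let $d\ge2$ and let $Q$ be a Hilbert qplex. Then the preservation group $\mathcal{G}(Q)$ is isomorphic to the projective extended unitary group $\mathrm{PEU}(d)$.
   Context: Fix an integer $d\ge 2$. $\langle\cdot,\cdot\rangle$ is the standard inner product on $\mathbb{R}^{d^2}$, $\|\cdot\|$ the Euclidean norm. $\Delta=\{p\in\mathbb{R}^{d^2}: p(i)\ge0,\ \sum_ip(i)=1\}$; $H=\{u\in\mathbb{R}^{d^2}:\sum_i u(i)=1\}$; $c=(1/d^2,\dots,1/d^2)$. For $A\subseteq H$ the polar is $A^*=\{u\in H:\langle u,v\rangle\ge\frac{1}{d(d+1)}\ \forall v\in A\}$. Out-ball $B_{\rm o}=\{u\in H:\|u-c\|\le r_{\rm o}\}$, $r_{\rm o}^2=\frac{d-1}{d^2(d+1)}$. A qplex is a set $Q\subseteq\Delta\cap B_{\rm o}$ with $Q^*=Q$. A measurement is an array $r(i|j)\ge0$ with $\sum_i r(i|j)=1$ for every $j$; for $q\in Q$, $q_r(i)=\sum_j[(d+1)q(j)-\frac1d]r(i|j)$; it is $Q$-preserving if $\{q_r:q\in Q\}=Q$; its stretched measurement matrix is $R_{ij}=(d+1)r(i|j)-\frac1d\sum_k r(i|k)$. The preservation group $\mathcal{G}(Q)$ is the set of stretched measurement matrices of $Q$-preserving measurements. Let $B_H$ be the real vector space of Hermitian operators on $\mathbb{C}^d$ and $S$ the set of density matrices. A qplex $Q$ is a Hilbert qplex if there is an $\mathbb{R}$-linear bijection $f:B_H\to\mathbb{R}^{d^2}$ with $f(S)=Q$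 and $\langle f(\rho),f(\rho')\rangle=\frac{\mathrm{Tr}(\rho\rho')+1}{d(d+1)}$ for all $\rho,\rho'\in S$. $\mathrm{EU}(d)$ is the group of all unitary and anti-unitary operators on $\mathbb{C}^d$, and $\mathrm{PEU}(d)=\mathrm{EU}(d)/\{e^{i\theta}I\}$. *)

theory Defs
  imports "HOL-Analysis.Analysis" "HOL-Algebra.Coset"
begin

text \<open>Dimension d = CARD('n). The space R^(d^2) is modelled as real^('n \<times> 'n)
  (an index type with d^2 elements); C^d is complex^'n; operators on C^d are complex^'n^'n.\<close>

abbreviation dim :: "'n::finite itself \<Rightarrow> real" where
  "dim _ \<equiv> real CARD('n)"

definition prob_simplex :: "(real^('n::finite \<times> 'n)) set" where
  "prob_simplex = {p. (\<forall>i. p $ i \<ge> 0) \<and> (\<Sum>i\<in>UNIV. p $ i) = 1}"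

definition qhyp :: "(real^('n::finite \<times> 'n)) set" where
  "qhyp = {u. (\<Sum>i\<in>UNIV. u $ i) = 1}"

definition qcentre :: "real^('n::finite \<times> 'n)" where
  "qcentre = (\<chi> i. 1 / (dim TYPE('n))^2)"

definition polar :: "(real^('n::finite \<times> 'n)) set \<Rightarrow> (real^('n \<times> 'n)) set" where
  "polar A = {u \<in> qhyp. \<forall>v\<in>A. inner u v \<ge> 1 / (dim TYPE('n) * (dim TYPE('n) + 1))}"

definition out_ball :: "(real^('n::finite \<times> 'n)) set" where
  "out_ball = {u \<in> qhyp. (norm (u - qcentre))^2 \<le>
      (dim TYPE('n) - 1) / ((dim TYPE('n))^2 * (dim TYPE('n) + 1))}"

definition qplex :: "(real^('n::finite \<times> 'n)) set \<Rightarrow> bool" where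
  "qplex Q \<longleftrightarrow> Q \<subseteq> prob_simplex \<inter> out_ball \<and> polar Q = Q"

text \<open>A measurement r(i|j) is stored as r \$ i \$ j.\<close>

definition measurement :: "real^('n::finite \<times> 'n)^('n \<times> 'n) \<Rightarrow> bool" where
  "measurement r \<longleftrightarrow> (\<forall>i j. r $ i $ j \<ge> 0) \<and> (\<forall>j. (\<Sum>i\<in>UNIV. r $ i $ j) = 1)"

definition meas_apply :: "real^('n::finite \<times> 'n)^('n \<times> 'n) \<Rightarrow> real^('n \<times> 'n) \<Rightarrow> real^('n \<times> 'n)" where
  "meas_apply r q = (\<chi> i. \<Sum>j\<in>UNIV. ((dim TYPE('n) + 1) * q $ j - 1 / dim TYPE('n)) * r $ i $ j)"

definition preserving :: "(real^('n::finite \<times> 'n)) set \<Rightarrow> real^('n \<times> 'n)^('n \<times> 'n) \<Rightarrow> bool" where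
  "preserving Q r \<longleftrightarrow> measurement r \<and> (meas_apply r) ` Q = Q"

definition stretched :: "real^('n::finite \<times> 'n)^('n \<times> 'n) \<Rightarrow> real^('n \<times> 'n)^('n \<times> 'n)" where
  "stretched r = (\<chi> i j. (dim TYPE('n) + 1) * r $ i $ j - (1 / dim TYPE('n)) * (\<Sum>k\<in>UNIV. r $ i $ k))"

definition pres_set :: "(real^('n::finite \<times> 'n)) set \<Rightarrow> (real^('n \<times> 'n)^('n \<times> 'n)) set" where
  "pres_set Q = stretched ` {r. preserving Q r}"

definition pres_group :: "(real^('n::finite \<times> 'n)) set \<Rightarrow> (real^('n \<times> 'n)^('n \<times> 'n)) monoid" where
  "pres_group Q = \<lparr>carrier = pres_set Q, mult = (\<lambda>A B. A ** B), one = mat 1\<rparr>"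

definition cinner :: "complex^'n::finite \<Rightarrow> complex^'n \<Rightarrow> complex" where
  "cinner x y = (\<Sum>i\<in>UNIV. cnj (x $ i) * y $ i)"

definition ctrace :: "complex^'n::finite^'n \<Rightarrow> complex" where
  "ctrace A = (\<Sum>i\<in>UNIV. A $ i $ i)"

definition hermitian :: "complex^'n::finite^'n \<Rightarrow> bool" where
  "hermitian A \<longleftrightarrow> (\<forall>i j. A $ i $ j = cnj (A $ j $ i))"

definition herm_ops :: "(complex^'n::finite^'n) set" where
  "herm_ops = {A. hermitian A}"

definition density_ops :: "(complex^'n::finite^'n) set" where
  "density_ops = {A. hermitian A \<and> (\<forall>v. 0 \<le> Re (cinner v (A *v v))) \<and> ctrace A = 1}"

definition hilbert_qplex :: "(real^('n::finite \<times> 'n)) set \<Rightarrow> bool" where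
  "hilbert_qplex Q \<longleftrightarrow> qplex Q \<and>
    (\<exists>f :: complex^'n^'n \<Rightarrow> real^('n \<times> 'n).
       (\<forall>a b X Y. X \<in> herm_ops \<longrightarrow> Y \<in> herm_ops \<longrightarrow>
           f (a *\<^sub>R X + b *\<^sub>R Y) = a *\<^sub>R f X + b *\<^sub>R f Y) \<and>
       bij_betw f herm_ops UNIV \<and>
       f ` density_ops = Q \<and>
       (\<forall>\<rho>\<in>density_ops. \<forall>\<rho>'\<in>density_ops.
           complex_of_real (inner (f \<rho>) (f \<rho>')) =
             (ctrace (\<rho> ** \<rho>') + 1) / complex_of_real (dim TYPE('n) * (dim TYPE('n) + 1))))"

definition unitary_op :: "(complex^'n::finite \<Rightarrow> complex^'n) \<Rightarrow> bool" where
  "unitary_op U \<longleftrightarrow> surj U \<and> (\<forall>x y. U (x + y) = U x + U y) \<and> (\<forall>c x. U (c *s x) = c *s U x)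
     \<and> (\<forall>x y. cinner (U x) (U y) = cinner x y)"

definition antiunitary_op :: "(complex^'n::finite \<Rightarrow> complex^'n) \<Rightarrow> bool" where
  "antiunitary_op U \<longleftrightarrow> surj U \<and> (\<forall>x y. U (x + y) = U x + U y) \<and> (\<forall>c x. U (c *s x) = cnj c *s U x)
     \<and> (\<forall>x y. cinner (U x) (U y) = cnj (cinner x y))"

definition EU_set :: "'n::finite itself \<Rightarrow> (complex^'n \<Rightarrow> complex^'n) set" where
  "EU_set _ = {U. unitary_op U \<or> antiunitary_op U}"

definition EU :: "'n::finite itself \<Rightarrow> (complex^'n \<Rightarrow> complex^'n) monoid" where
  "EU t = \<lparr>carrier = EU_set t, mult = (\<lambda>U V. U \<circ> V), one = id\<rparr>"

definition phases :: "'n::finite itself \<Rightarrow> (complex^'n \<Rightarrow> complex^'n) set" where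
  "phases _ = {(\<lambda>x. exp (\<i> * complex_of_real \<theta>) *s x) | \<theta>. True}"

definition PEU :: "'n::finite itself \<Rightarrow> (complex^'n \<Rightarrow> complex^'n) set monoid" where
  "PEU t = EU t Mod phases t"

end

theory Submission
  imports Defs
begin

text \<open>
  Linearity turns \<open>Q\<close>-preserving measurements into the linear bijections \<open>R\<close> of \<open>\<real>\<^bsup>d\<^sup>2\<^esup>\<close> with
  \<open>R Q = Q\<close>, hence, through \<open>f\<close>, into the linear maps \<open>\<Phi>\<close> on Hermitian operators that permute the density
  operators. Such a \<open>\<Phi>\<close> maps the extreme rays \<open>xx\<^sup>*\<close> of the positive cone to extreme rays, and it preserves
  transition probabilities, because \<open>|\<langle>x,y\<rangle>|\<^sup>2\<close> is the minimum of \<open>e(yy\<^sup>*)\<close> over the affine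
  functionals \<open>e\<close> from the states to \<open>[0,1]\<close> with \<open>e(xx\<^sup>*) = 1\<close>. Wigner's theorem then gives a unitary
  or antiunitary \<open>U\<close> with \<open>\<Phi>(xx\<^sup>*) = (Ux)(Ux)\<^sup>*\<close>. Conversely every such \<open>U\<close> acts in this way, and it
  acts trivially only if it is a phase.
\<close>

section \<open>Rank-one operators and the positive cone\<close>

definition rank_one :: "complex^'n::finite \<Rightarrow> complex^'n^'n" where
  "rank_one x = (\<chi> i j. x $ i * cnj (x $ j))"

definition cross_op :: "complex^'n::finite \<Rightarrow> complex^'n \<Rightarrow> complex^'n^'n" where
  "cross_op x y = (\<chi> i j. x $ i * cnj (y $ j) + y $ i * cnj (x $ j))"

text \<open>Positivity is tested by the real functionals \<open>inner _ (rank_one v)\<close>, which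
  are the quadratic form of \<open>A\<close> by \<open>inner_rank_one\<close>. The operators
  \<open>rank_one v\<close> thus serve both as elements of the cone and as its test
  functionals.\<close>

definition psd :: "complex^'n::finite^'n \<Rightarrow> bool" where
  "psd A \<longleftrightarrow> hermitian A \<and> (\<forall>v. 0 \<le> inner A (rank_one v))"

lemma inner_rank_one: "inner A (rank_one v) = Re (cinner v (A *v v))"
proof -
  have "cinner v (A *v v) = (\<Sum>i\<in>UNIV. \<Sum>j\<in>UNIV. cnj (v $ i) * (A $ i $ j * v $ j))"
    by (simp add: cinner_def matrix_vector_mult_def sum_distrib_left)
  moreover have "inner (A $ i $ j) (rank_one v $ i $ j) = Re (cnj (v $ i) * (A $ i $ j * v $ j))" for i j
    by (simp add: rank_one_def inner_complex_def algebra_simps)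
  ultimately show ?thesis
    by (simp add: inner_vec_def)
qed

lemma cnj_cinner: "cnj (cinner x y) = cinner y x"
  by (simp add: cinner_def mult.commute)

lemma cinner_add_right: "cinner x (y + z) = cinner x y + cinner x z"
  by (simp add: cinner_def algebra_simps sum.distrib)

lemma cinner_add_left: "cinner (x + y) z = cinner x z + cinner y z"
  by (simp add: cinner_def algebra_simps sum.distrib)

lemma cinner_diff_right: "cinner x (y - z) = cinner x y - cinner x z"
  by (simp add: cinner_def algebra_simps sum_subtractf)

lemma cinner_scale_right: "cinner x (c *s y) = c * cinner x y"
  by (simp add: cinner_def algebra_simps sum_distrib_left)

lemma cinner_scale_left: "cinner (c *s x) y = cnj c * cinner x y"
  by (simp add: cinner_def algebra_simps sum_distrib_left)

lemma cinner_self: "cinner x x = of_real ((norm x)\<^sup>2)"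
proof -
  have "(norm x)\<^sup>2 = (\<Sum>i\<in>UNIV. (cmod (x $ i))\<^sup>2)"
    by (simp add: norm_vec_def L2_set_def sum_nonneg)
  then show ?thesis
    by (simp only: cinner_def of_real_sum complex_norm_square mult.commute[of "cnj _"])
qed

lemma cinner_axis_left: "cinner (axis i c) y = cnj c * y $ i"
  by (simp add: cinner_def axis_def if_distrib[of cnj] if_distrib[of "\<lambda>z. z * _"] cong: if_cong)

lemma cinner_axis_right: "cinner y (axis i c) = cnj (y $ i) * c"
  by (simp add: cinner_def axis_def if_distrib[of "\<lambda>z. _ * z"] cong: if_cong)

lemma rank_one_mult: "rank_one x *v y = cinner x y *s x"
  by (simp add: vec_eq_iff rank_one_def matrix_vector_mult_def cinner_def sum_distrib_left algebra_simps)

lemma inner_rank_one_rank_one: "inner (rank_one x) (rank_one y) = (cmod (cinner x y))\<^sup>2"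
proof -
  have "cinner x y * cinner y x = of_real ((cmod (cinner x y))\<^sup>2)"
    by (metis cnj_cinner complex_norm_square)
  then show ?thesis
    by (simp add: inner_rank_one rank_one_mult cinner_scale_right)
qed

lemma inner_mat1_rank_one: "inner (mat 1) (rank_one x) = (norm x)\<^sup>2"
  by (simp add: inner_rank_one cinner_self)

text \<open>Pythagoras: the subtracted multiple of \<open>x\<close> is the orthogonal projection of
  \<open>y\<close> onto the line of \<open>x\<close>.\<close>

lemma norm_diff_projection:
  assumes "x \<noteq> 0"
  shows "(norm (y - (cinner x y / of_real ((norm x)\<^sup>2)) *s x))\<^sup>2 =
    (norm y)\<^sup>2 - (cmod (cinner x y))\<^sup>2 / (norm x)\<^sup>2"
proof -
  define a where "a = cinner x y / of_real ((norm x)\<^sup>2)"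
  have "cinner (y - a *s x) (y - a *s x) = cinner (y - a *s x) y - a * cinner (y - a *s x) x"
    by (simp add: cinner_diff_right cinner_scale_right)
  also have "cinner (y - a *s x) x = cnj (cinner x (y - a *s x))" by (simp add: cnj_cinner)
  also have "cinner x (y - a *s x) = 0"
    using assms by (simp add: cinner_diff_right cinner_scale_right a_def cinner_self)
  also have "cinner (y - a *s x) y = cnj (cinner y (y - a *s x))" by (simp add: cnj_cinner)
  also have "\<dots> = cinner y y - cnj a * cinner x y"
    by (simp add: cinner_diff_right cinner_scale_right cnj_cinner)
  also have "cnj a * cinner x y = of_real ((cmod (cinner x y))\<^sup>2 / (norm x)\<^sup>2)"
    by (simp add: a_def complex_norm_square mult.commute del: of_real_power)
  finally have "complex_of_real ((norm (y - a *s x))\<^sup>2) =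
      of_real ((norm y)\<^sup>2 - (cmod (cinner x y))\<^sup>2 / (norm x)\<^sup>2)"
    by (simp add: cinner_self)
  then show ?thesis unfolding a_def of_real_eq_iff .
qed

lemma cmod_cinner_le: "(cmod (cinner x y))\<^sup>2 \<le> (norm x)\<^sup>2 * (norm y)\<^sup>2"
proof (cases "x = 0")
  case True
  then show ?thesis by (simp add: cinner_def)
next
  case False
  then have "0 \<le> (norm y)\<^sup>2 - (cmod (cinner x y))\<^sup>2 / (norm x)\<^sup>2"
    by (metis norm_diff_projection zero_le_power2)
  with False show ?thesis by (simp add: field_simps)
qed

lemma rank_one_add: "rank_one (x + y) = rank_one x + cross_op x y + rank_one y"
  by (simp add: vec_eq_iff rank_one_def cross_op_def algebra_simps)

lemma rank_one_scale: "rank_one (c *s x) = (cmod c)\<^sup>2 *\<^sub>R rank_one x"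
proof -
  have "c * a * (cnj c * b) = of_real ((cmod c)\<^sup>2) * (a * b)" for a b
    unfolding complex_norm_square by simp
  then show ?thesis by (simp add: vec_eq_iff rank_one_def scaleR_conv_of_real[where 'a = complex] del: of_real_power mult_cancel_left mult_cancel_right)
qed

lemma cross_op_scale: "cross_op x (of_real t *s y) = t *\<^sub>R cross_op x y"
  by (simp add: vec_eq_iff cross_op_def scaleR_conv_of_real[where 'a = complex] algebra_simps)

lemma rank_one_scale_real: "rank_one (of_real t *s x) = t\<^sup>2 *\<^sub>R rank_one x"
  by (simp add: rank_one_scale)

lemma hermitian_rank_one: "hermitian (rank_one x)"
  by (simp add: hermitian_def rank_one_def)

lemma rank_one_eq_0_iff: "rank_one x = 0 \<longleftrightarrow> x = 0"
  by (auto simp: vec_eq_iff rank_one_def)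

lemma psd_rank_one: "psd (rank_one x)"
  by (simp add: psd_def hermitian_rank_one inner_rank_one_rank_one)

lemma subspace_herm_ops: "subspace (herm_ops :: (complex^'n::finite^'n) set)"
proof (rule subspaceI)
  fix A B :: "complex^'n^'n" and c :: real
  assume A: "A \<in> herm_ops" and B: "B \<in> herm_ops"
  have A': "cnj (A $ i $ j) = A $ j $ i" and B': "cnj (B $ i $ j) = B $ j $ i" for i j
    using A[unfolded herm_ops_def hermitian_def, simplified, rule_format, of i j]
      B[unfolded herm_ops_def hermitian_def, simplified, rule_format, of i j]
    by simp_all
  show "A + B \<in> herm_ops" "c *\<^sub>R A \<in> herm_ops"
    by (simp_all add: herm_ops_def hermitian_def A' B')
qed (simp add: herm_ops_def hermitian_def)

lemma linear_term_zero:
  fixes b c :: real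
  assumes "\<And>t. 0 \<le> t * b + t\<^sup>2 * c"
  shows "b = 0"
proof (rule ccontr)
  assume b: "b \<noteq> 0"
  \<comment> \<open>Since \<open>k\<close> exceeds both 0 and \<open>c\<close>, at
    \<open>t = - b / k\<close> the linear term outweighs the quadratic one.\<close>
  define k where "k = \<bar>c\<bar> + 1"
  have k: "k > 0" "c < k" by (auto simp: k_def)
  have "(- b / k) * b + (- b / k)\<^sup>2 * c = (b\<^sup>2 / k\<^sup>2) * (c - k)"
    using k by (simp add: field_simps power2_eq_square)
  moreover have "\<dots> < 0" using b k by (intro mult_pos_neg) simp_all
  ultimately show False using assms[of "- b / k"] by simp
qed

text \<open>A null vector of a nonnegative quadratic form lies in its radical: along
  \<open>w\<close> scaled by a real \<open>t\<close>, a nonzero cross term would make the form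
  negative for small \<open>t\<close> of the right sign.\<close>

lemma rank_one_null_vector:
  fixes e :: "complex^'n::finite^'n \<Rightarrow> real"
  assumes "linear e" and nonneg: "\<And>v. 0 \<le> e (rank_one v)" and "e (rank_one v) = 0"
  shows "e (rank_one (v + w)) = e (rank_one w)"
proof -
  interpret linear e by fact
  have "0 \<le> t * e (cross_op v w) + t\<^sup>2 * e (rank_one w)" for t
    using nonneg[of "v + of_real t *s w"] assms(3)
    by (simp add: rank_one_add cross_op_scale rank_one_scale_real add scale)
  then have "e (cross_op v w) = 0" by (rule linear_term_zero)
  then show ?thesis by (simp add: rank_one_add add assms(3))
qed

text \<open>Polarisation: vanishing of the quadratic form gives vanishing pairings with every
  \<open>cross_op v w\<close>, and these recover the entries.\<close>

lemma hermitian_eq_0: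
  fixes A :: "complex^'n::finite^'n"
  assumes "hermitian A" and "\<And>v. inner A (rank_one v) = 0"
  shows "A = 0"
proof -
  have A: "cnj (A $ i $ j) = A $ j $ i" for i j
    using assms(1)[unfolded hermitian_def, rule_format, of j i] by simp
  have cross0: "inner A (cross_op v w) = 0" for v w
    using assms(2)[of "v + w"] by (simp add: rank_one_add inner_add_right assms(2))
  have "A $ i $ j = 0" for i j
  proof -
    \<comment> \<open>With this coefficient both summands of the pairing equal the squared modulus
      of \<open>A $ i $ j\<close>, so real and imaginary part are tested at once.\<close>
    let ?y = "axis j (cnj (A $ i $ j)) :: complex^'n"
    have "inner A (cross_op (axis i 1) ?y) = 2 * (cmod (A $ i $ j))\<^sup>2"
    proof -
      have P: "cross_op (axis i 1) ?y $ k $ l =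
          (if k = i then if l = j then A $ i $ j else 0 else 0)
          + (if k = j then if l = i then A $ j $ i else 0 else 0)" for k l
        using A by (auto simp: cross_op_def axis_def)
      have delta1: "(\<Sum>l\<in>UNIV. if k = p then if l = q then a else 0 else 0) = (if k = p then a else 0)"
        for k p q :: 'n and a :: real
        by (cases "k = p") simp_all
      have delta: "(\<Sum>k\<in>UNIV. \<Sum>l\<in>UNIV. if k = p then if l = q then a else 0 else 0) = a"
        for p q :: 'n and a :: real
        by (simp only: delta1) simp
      have "inner A (cross_op (axis i 1) ?y) = inner (A $ i $ j) (A $ i $ j) + inner (A $ j $ i) (A $ j $ i)"
        by (simp add: inner_vec_def[of A] inner_vec_def[of "A $ _"] P inner_add_right sum.distrib
            if_distrib[of "inner _"] delta cong: if_cong)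
      also have "A $ j $ i = cnj (A $ i $ j)" by (simp add: A)
      finally show ?thesis by (simp add: power2_norm_eq_inner[symmetric])
    qed
    then show ?thesis using cross0 by simp
  qed
  then show ?thesis by (simp add: vec_eq_iff)
qed

text \<open>The component of a Hermitian operator orthogonal to the span is again Hermitian and has
  zero quadratic form, so \<open>hermitian_eq_0\<close> removes it. Linear identities on Hermitian
  operators may therefore be checked on rank-one operators.\<close>

lemma herm_ops_subset_span: "(herm_ops :: (complex^'n::finite^'n) set) \<subseteq> span (range rank_one)"
proof
  fix X :: "complex^'n^'n" assume X: "X \<in> herm_ops"
  obtain y z where y: "y \<in> span (range rank_one)"
    and z: "\<And>w. w \<in> span (range rank_one) \<Longrightarrow> orthogonal z w" and Xyz: "X = y + z"
    using orthogonal_subspace_decomp_exists[of "range rank_one" X] by metis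
  have "span (range rank_one) \<subseteq> (herm_ops :: (complex^'n^'n) set)"
    by (rule span_minimal[OF _ subspace_herm_ops]) (auto simp: herm_ops_def hermitian_rank_one)
  then have "X - y \<in> herm_ops" using X y subspace_diff[OF subspace_herm_ops] by blast
  then have "hermitian z" by (simp add: Xyz herm_ops_def)
  moreover have "inner z (rank_one v) = 0" for v
    using z[of "rank_one v"] by (simp add: orthogonal_def span_base)
  ultimately have "z = 0" by (rule hermitian_eq_0)
  then show "X \<in> span (range rank_one)" using y Xyz by simp
qed

lemma linear_eq_on_herm_ops:
  assumes "linear F" "linear G" "\<And>x. F (rank_one x) = G (rank_one x)" "X \<in> herm_ops"
  shows "F X = G X"
  using linear_eq_on_span[OF assms(1,2), of "range rank_one" X] assms(3,4) herm_ops_subset_span by auto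

text \<open>Extremality of the ray: on vectors orthogonal to \<open>x\<close> the forms of
  \<open>P\<close> and \<open>C\<close> are nonnegative with sum zero, so such vectors are null for
  \<open>P\<close>, and \<open>rank_one_null_vector\<close> leaves only the component along
  \<open>x\<close>.\<close>

lemma psd_summand_of_rank_one:
  fixes P C :: "complex^'n::finite^'n"
  assumes "psd P" "psd C" "rank_one x = P + C"
  obtains c where "0 \<le> c" "P = c *\<^sub>R rank_one x"
proof -
  \<comment> \<open>Evaluating the claim at \<open>x\<close> forces this value; for
    \<open>x = 0\<close> division by zero makes it 0.\<close>
  define c where "c = inner P (rank_one x) / (norm x)^4"
  have "inner (P - c *\<^sub>R rank_one x) (rank_one w) = 0" for w
  proof (cases "x = 0")
    case True
    then have "P + C = 0" using assms(3) rank_one_eq_0_iff[of x] by simp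
    then have "inner P (rank_one w) + inner C (rank_one w) = 0"
      by (metis inner_add_left inner_zero_left)
    then have "inner P (rank_one w) = 0" using assms(1,2) by (smt (verit) psd_def)
    then show ?thesis using True by (simp add: c_def)
  next
    case False
    define a where "a = cinner x w / of_real ((norm x)\<^sup>2)"
    have "cinner x (w - a *s x) = 0"
      using False by (simp add: cinner_diff_right cinner_scale_right a_def cinner_self)
    then have "inner (P + C) (rank_one (w - a *s x)) = 0"
      by (simp add: assms(3)[symmetric] inner_rank_one_rank_one)
    then have "inner P (rank_one (w - a *s x)) = 0"
      using assms(1,2) unfolding psd_def inner_add_left by (smt (verit))
    then have "inner P (rank_one ((w - a *s x) + a *s x)) = inner P (rank_one (a *s x))"
      using assms(1) by (intro rank_one_null_vector) (auto simp: psd_def bounded_linear.linear bounded_linear_inner_right)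
    then have "inner P (rank_one w) = (cmod a)\<^sup>2 * inner P (rank_one x)"
      by (simp add: rank_one_scale)
    also have "\<dots> = c * (cmod (cinner x w))\<^sup>2"
      using False by (simp add: a_def c_def norm_divide power_divide norm_power flip: power_mult)
    finally show ?thesis
      by (simp add: inner_diff_left inner_rank_one_rank_one)
  qed
  moreover have "hermitian (P - c *\<^sub>R rank_one x)"
    using subspace_diff[OF subspace_herm_ops] subspace_scale[OF subspace_herm_ops] assms(1) hermitian_rank_one
    by (metis herm_ops_def mem_Collect_eq psd_def)
  ultimately have "P - c *\<^sub>R rank_one x = 0" by (intro hermitian_eq_0)
  moreover have "0 \<le> c" using assms(1) by (simp add: c_def psd_def)
  ultimately show ?thesis using that by simp
qed

text \<open>Cauchy-Schwarz for the form of \<open>A\<close>: the squared overlap of \<open>w\<close>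
  with \<open>A *v v\<close> is at most the product of the forms at \<open>v\<close> and
  \<open>w\<close>. Dividing \<open>A *v v\<close> by the square root of the form at
  \<open>v\<close> hence gives a rank-one operator below \<open>A\<close>.\<close>

lemma psd_rank_one_summand:
  fixes A :: "complex^'n::finite^'n"
  assumes "psd A" "A \<noteq> 0"
  obtains z C where "z \<noteq> 0" "psd C" "A = rank_one z + C"
proof -
  obtain v where "inner A (rank_one v) \<noteq> 0" using assms hermitian_eq_0 psd_def by blast
  define m where "m = inner A (rank_one v)"
  have m: "m > 0" using \<open>inner A _ \<noteq> 0\<close> assms(1) unfolding psd_def m_def by (metis less_le)
  define z where "z = of_real (1 / sqrt m) *s (A *v v)"
  have A: "cnj (A $ j $ i) = A $ i $ j" for i j
    using assms(1)[unfolded psd_def hermitian_def, THEN conjunct1, rule_format, of i j] by simp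
  have herm: "cinner x (A *v y) = cinner (A *v x) y" for x y
  proof -
    have "cinner x (A *v y) = (\<Sum>i\<in>UNIV. \<Sum>j\<in>UNIV. cnj (x $ i) * (A $ i $ j * y $ j))"
      by (simp add: cinner_def matrix_vector_mult_def sum_distrib_left)
    also have "\<dots> = (\<Sum>j\<in>UNIV. \<Sum>i\<in>UNIV. cnj (x $ i) * (cnj (A $ j $ i) * y $ j))"
      using A by (subst sum.swap) simp
    also have "\<dots> = cinner (A *v x) y"
      by (simp add: cinner_def matrix_vector_mult_def sum_distrib_left algebra_simps)
    finally show ?thesis .
  qed
  have "0 \<le> inner (A - rank_one z) (rank_one w)" for w
  proof -
    define s where "s = cinner w (A *v v)"
    \<comment> \<open>This \<open>c\<close> minimises the form of \<open>A\<close> at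
      \<open>w + c *s v\<close>; nonnegativity at the minimum is the required bound.\<close>
    define c where "c = - cnj s / of_real m"
    have zw: "(cmod (cinner z w))\<^sup>2 = (cmod s)\<^sup>2 / m"
    proof -
      have "cinner z w = of_real (1 / sqrt m) * cnj s"
        by (simp add: z_def s_def cinner_scale_left cnj_cinner)
      then show ?thesis using m by (simp add: norm_mult power_mult_distrib norm_divide power_divide)
    qed
    have "0 \<le> Re (cinner (w + c *s v) (A *v (w + c *s v)))"
      using assms(1) by (simp add: psd_def flip: inner_rank_one)
    also have "cinner (w + c *s v) (A *v (w + c *s v)) =
       cinner w (A *v w) + c * s + cnj c * cinner v (A *v w) + (cnj c * c) * cinner v (A *v v)"
      by (simp add: matrix_vector_right_distrib matrix_vector_mult_scaleR vector_scalar_commute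
          cinner_add_left cinner_add_right cinner_scale_left cinner_scale_right s_def algebra_simps)
    also have "cinner v (A *v w) = cnj s" by (simp add: s_def cnj_cinner herm)
    also have "c * s = - of_real ((cmod s)\<^sup>2 / m)"
      by (simp add: c_def complex_norm_square mult.commute del: of_real_power)
    also have "cnj c * cnj s = - of_real ((cmod s)\<^sup>2 / m)"
      by (simp add: c_def complex_norm_square mult.commute del: of_real_power)
    also have "cnj c * c = of_real ((cmod s)\<^sup>2 / m\<^sup>2)"
      by (simp add: c_def complex_norm_square mult.commute power2_eq_square[of m] del: of_real_power)
    finally have "0 \<le> inner A (rank_one w) - 2 * ((cmod s)\<^sup>2 / m) + (cmod s)\<^sup>2 / m\<^sup>2 * m"
      by (simp add: inner_rank_one m_def)
    then show ?thesis
      using m by (simp add: inner_diff_left inner_rank_one_rank_one zw power2_eq_square[of m])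
  qed
  moreover have "hermitian (A - rank_one z)"
    using subspace_diff[OF subspace_herm_ops] assms(1) hermitian_rank_one
    by (metis herm_ops_def mem_Collect_eq psd_def)
  ultimately have "psd (A - rank_one z)" by (simp add: psd_def)
  moreover have "z \<noteq> 0"
  proof
    assume "z = 0"
    then have "A *v v = 0" using m by (simp add: z_def)
    then show False using m by (simp add: m_def inner_rank_one cinner_def)
  qed
  ultimately show ?thesis using that[of z "A - rank_one z"] by simp
qed

section \<open>Automorphisms of the positive cone\<close>

text \<open>The maps are linear on all matrices, while positivity, inversion and trace are demanded
  on the cone only. Carrying the inverse explicitly keeps the situation symmetric, so each result
  also applies to \<open>\<Psi>\<close>.\<close>

locale psd_cone_automorphism =
  fixes \<Phi> \<Psi> :: "complex^'n::finite^'n \<Rightarrow> complex^'n^'n"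
  assumes linear_\<Phi>: "linear \<Phi>" and linear_\<Psi>: "linear \<Psi>"
    and psd_\<Phi>: "psd A \<Longrightarrow> psd (\<Phi> A)" and psd_\<Psi>: "psd A \<Longrightarrow> psd (\<Psi> A)"
    and \<Psi>_\<Phi>: "psd A \<Longrightarrow> \<Psi> (\<Phi> A) = A" and \<Phi>_\<Psi>: "psd A \<Longrightarrow> \<Phi> (\<Psi> A) = A"
    and trace_\<Phi>: "psd A \<Longrightarrow> inner (mat 1) (\<Phi> A) = inner (mat 1) A"
begin

lemma inverse_automorphism: "psd_cone_automorphism \<Psi> \<Phi>"
  by unfold_locales
    (auto simp: linear_add[OF linear_\<Phi>] linear_add[OF linear_\<Psi>] linear_cmul[OF linear_\<Phi>]
      linear_cmul[OF linear_\<Psi>] psd_\<Phi> psd_\<Psi> \<Phi>_\<Psi> \<Psi>_\<Phi> trace_\<Phi>[OF psd_\<Psi>, symmetric])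

text \<open>Extremality is transported: a rank-one summand of the image pulls back to a summand of
  \<open>rank_one x\<close>, hence to a multiple of it, so the image is a multiple of that
  summand.\<close>

lemma rank_one_image: "\<exists>y. \<Phi> (rank_one x) = rank_one y"
proof (cases "\<Phi> (rank_one x) = 0")
  case True
  then show ?thesis by (metis rank_one_eq_0_iff)
next
  case False
  obtain z C where z: "z \<noteq> 0" "psd C" "\<Phi> (rank_one x) = rank_one z + C"
    using psd_rank_one_summand[OF psd_\<Phi>[OF psd_rank_one] False] by blast
  have "rank_one x = \<Psi> (rank_one z) + \<Psi> C"
    using \<Psi>_\<Phi>[OF psd_rank_one, of x] by (simp add: z(3) linear_add[OF linear_\<Psi>])
  then obtain c where c: "0 \<le> c" "\<Psi> (rank_one z) = c *\<^sub>R rank_one x"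
    using psd_summand_of_rank_one psd_\<Psi> psd_rank_one z(2) by metis
  then have eq: "rank_one z = c *\<^sub>R \<Phi> (rank_one x)"
    using \<Phi>_\<Psi>[OF psd_rank_one, of z] by (simp add: linear_cmul[OF linear_\<Phi>])
  then have "c \<noteq> 0" using z(1) rank_one_eq_0_iff by fastforce
  then have "\<Phi> (rank_one x) = rank_one (of_real (1 / sqrt c) *s z)"
    using c(1) unfolding rank_one_scale_real by (simp add: eq power_divide)
  then show ?thesis by blast
qed

text \<open>A representative chosen separately for each \<open>x\<close> and determined only up to a
  phase; only moduli of its inner products carry meaning.\<close>

definition vec_image :: "complex^'n \<Rightarrow> complex^'n" where
  "vec_image x = (SOME y. \<Phi> (rank_one x) = rank_one y)"

lemma rank_one_vec_image: "\<Phi> (rank_one x) = rank_one (vec_image x)"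
  unfolding vec_image_def by (rule someI_ex[OF rank_one_image])

lemma norm_vec_image: "norm (vec_image x) = norm x"
  using trace_\<Phi>[OF psd_rank_one, of x] by (simp add: rank_one_vec_image inner_mat1_rank_one)

text \<open>For unit \<open>x\<close> the functional \<open>X \<mapsto> \<langle>xx\<^sup>*, \<Psi> X\<rangle>\<close> takes values in \<open>[0, 1]\<close> on states and equals \<open>1\<close> at \<open>\<Phi>(xx\<^sup>*)\<close>; the overlap
  with \<open>\<Phi>(xx\<^sup>*)\<close> is the least functional with this property.\<close>

lemma transition_le: "inner (\<Phi> (rank_one x)) (\<Phi> (rank_one y)) \<le> inner (rank_one x) (rank_one y)"
proof (cases "x = 0")
  case True
  then have "rank_one x = 0" by (simp add: rank_one_eq_0_iff)
  then show ?thesis by (simp add: linear_0[OF linear_\<Phi>])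
next
  case False
  interpret inv: psd_cone_automorphism \<Psi> \<Phi> by (rule inverse_automorphism)
  define x' y' where "x' = vec_image x" and "y' = vec_image y"
  have norms: "norm x' = norm x" "norm y' = norm y" by (simp_all add: x'_def y'_def norm_vec_image)
  \<comment> \<open>The complementary functional, scaled so that \<open>x\<close> need not be a unit
    vector: nonnegative on rank-one operators and zero at \<open>rank_one x'\<close>.\<close>
  define e where "e X = (norm x)\<^sup>2 * inner (mat 1) X - inner (rank_one x) (\<Psi> X)" for X
  have e_rank_one: "e (rank_one v) = (norm x)\<^sup>2 * (norm v)\<^sup>2 - inner (rank_one x) (\<Psi> (rank_one v))" for v
    by (simp add: e_def inner_mat1_rank_one)
  have lin: "linear e"
    unfolding e_def
    by (rule linearI) (simp_all add: linear_add[OF linear_\<Psi>] linear_cmul[OF linear_\<Psi>] inner_add_right algebra_simps)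
  have nonneg: "0 \<le> e (rank_one v)" for v
    using cmod_cinner_le[of x "inv.vec_image v"]
    by (simp add: e_rank_one inv.rank_one_vec_image inner_rank_one_rank_one inv.norm_vec_image)
  define a where "a = cinner x' y' / of_real ((norm x)\<^sup>2)"
  have "e (rank_one (a *s x')) = 0"
  proof -
    have "\<Psi> (rank_one x') = rank_one x"
      by (simp add: x'_def \<Psi>_\<Phi> psd_rank_one flip: rank_one_vec_image)
    then have "e (rank_one x') = 0"
      by (simp add: e_rank_one norms inner_rank_one_rank_one cinner_self norm_power flip: power_add power_mult)
    then show ?thesis by (simp add: rank_one_scale linear_cmul[OF lin])
  qed
  \<comment> \<open>The component \<open>a *s x'\<close> of \<open>y'\<close> is a null vector of
    \<open>e\<close>, so only the part of \<open>y'\<close> orthogonal to \<open>x'\<close>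
    contributes.\<close>
  with lin nonneg have "e (rank_one (a *s x' + (y' - a *s x'))) = e (rank_one (y' - a *s x'))"
    by (rule rank_one_null_vector)
  also have "\<dots> \<le> (norm x)\<^sup>2 * (norm (y' - a *s x'))\<^sup>2"
    using psd_\<Psi>[OF psd_rank_one, of "y' - a *s x'"]
    by (simp add: e_rank_one psd_def inner_commute)
  finally have "(norm x)\<^sup>2 * ((norm y')\<^sup>2 - (norm (y' - a *s x'))\<^sup>2) \<le> inner (rank_one x) (\<Psi> (rank_one y'))"
    by (simp add: e_rank_one algebra_simps)
  also have "\<Psi> (rank_one y') = rank_one y" by (simp add: y'_def \<Psi>_\<Phi> psd_rank_one flip: rank_one_vec_image)
  also have "(norm y')\<^sup>2 - (norm (y' - a *s x'))\<^sup>2 = (cmod (cinner x' y'))\<^sup>2 / (norm x)\<^sup>2"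
  proof -
    have "x' \<noteq> 0" using False norms(1) by auto
    then show ?thesis using norm_diff_projection[of x' y'] norms a_def by simp
  qed
  finally have "(cmod (cinner x' y'))\<^sup>2 \<le> inner (rank_one x) (rank_one y)"
    using False by simp
  then show ?thesis
    by (simp add: rank_one_vec_image inner_rank_one_rank_one x'_def y'_def)
qed

lemma transition_eq: "inner (\<Phi> (rank_one x)) (\<Phi> (rank_one y)) = inner (rank_one x) (rank_one y)"
proof (rule antisym[OF transition_le])
  interpret inv: psd_cone_automorphism \<Psi> \<Phi> by (rule inverse_automorphism)
  show "inner (rank_one x) (rank_one y) \<le> inner (\<Phi> (rank_one x)) (\<Phi> (rank_one y))"
    using inv.transition_le[of "vec_image x" "vec_image y"]
    by (simp add: \<Psi>_\<Phi> psd_rank_one flip: rank_one_vec_image)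
qed

lemma cmod_cinner_vec_image: "cmod (cinner (vec_image x) (vec_image y)) = cmod (cinner x y)"
  using transition_eq[of x y] by (simp add: rank_one_vec_image inner_rank_one_rank_one)

end

section \<open>Wigner's theorem: relative phases of coordinates\<close>

lemma unit_orthogonal_complex:
  assumes "cmod a = 1" "cmod b = 1" "Re (a * cnj b) = 0"
  shows "b = \<i> * a \<or> b = - \<i> * a"
proof -
  define k where "k = b * cnj a"
  have "b = k * a"
    using assms(1) by (metis k_def complex_norm_square mult.assoc mult.commute mult.right_neutral of_real_1 one_power2)
  moreover have "Re k = 0" using assms(3) by (simp add: k_def algebra_simps)
  moreover have "cmod k = 1" using assms by (simp add: k_def norm_mult)
  ultimately have "Im k = 1 \<or> Im k = - 1" by (simp add: cmod_def abs_if split: if_splits)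
  with \<open>Re k = 0\<close> have "k = \<i> \<or> k = - \<i>" by (auto simp: complex_eq_iff)
  with \<open>b = k * a\<close> show ?thesis by auto
qed

text \<open>Testing against the vectors \<open>e\<^sub>i + \<omega> e\<^sub>j\<close> with \<open>\<omega> \<in> {1, \<i>}\<close> recovers the real and
  the imaginary part of the phase between two coordinates.\<close>

lemma wigner_pair:
  fixes W :: "complex^'n::finite \<Rightarrow> complex^'n"
  assumes cinner_W: "\<And>x y. cmod (cinner (W x) (W y)) = cmod (cinner x y)"
    and coord_W: "\<And>x i. cmod (W x $ i) = cmod (x $ i)"
    and "i \<noteq> j"
  shows "\<exists>a. cmod a = 1 \<and> ((\<forall>x. W x $ i * cnj (W x $ j) = a * (x $ i * cnj (x $ j))) \<or>
      (\<forall>x. W x $ i * cnj (W x $ j) = a * cnj (x $ i * cnj (x $ j))))"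
proof -
  define t where "t w = (axis i 1 + axis j w :: complex^'n)" for w
  \<comment> \<open>The counterpart of \<open>w\<close> after applying \<open>W\<close>, since
    \<open>cnj (t w $ i) * t w $ j = w\<close>.\<close>
  define p where "p w = cnj (W (t w) $ i) * W (t w) $ j" for w
  have t: "t w $ i = 1" "t w $ j = w" "k \<noteq> i \<Longrightarrow> k \<noteq> j \<Longrightarrow> t w $ k = 0" for w k
    using \<open>i \<noteq> j\<close> by (auto simp: t_def axis_def)
  have two: "cinner u v = cnj (u $ i) * v $ i + cnj (u $ j) * v $ j"
    if "\<And>k. k \<noteq> i \<Longrightarrow> k \<noteq> j \<Longrightarrow> u $ k = 0" for u v :: "complex^'n"
  proof -
    have "cinner u v = (\<Sum>k\<in>{i, j}. cnj (u $ k) * v $ k)"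
      unfolding cinner_def by (rule sum.mono_neutral_right) (auto simp: that)
    then show ?thesis using \<open>i \<noteq> j\<close> by simp
  qed
  have sq: "(cmod (cnj a * b + cnj c * d))\<^sup>2 =
      (cmod a * cmod b)\<^sup>2 + (cmod c * cmod d)\<^sup>2 + 2 * Re ((cnj a * c) * (b * cnj d))" for a b c d
    by (simp add: cmod_power2 power_mult_distrib) (simp add: power2_eq_square algebra_simps)
  \<comment> \<open>In the equality of squared overlaps the diagonal terms agree by
    \<open>coord_W\<close>; the real part of the cross term remains.\<close>
  have Re_eq: "Re (p w * (W x $ i * cnj (W x $ j))) = Re (w * (x $ i * cnj (x $ j)))" for w x
  proof -
    have 1: "cinner (W (t w)) (W x) = cnj (W (t w) $ i) * W x $ i + cnj (W (t w) $ j) * W x $ j"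
      by (rule two) (metis coord_W norm_eq_zero t(3))
    have 2: "cinner (t w) x = cnj (t w $ i) * x $ i + cnj (t w $ j) * x $ j"
      by (rule two) (rule t(3))
    have "(cmod (cinner (W (t w)) (W x)))\<^sup>2 = (cmod (cinner (t w) x))\<^sup>2" by (simp add: cinner_W)
    then show ?thesis unfolding 1 2 sq by (simp add: coord_W p_def t)
  qed
  have cmod_p: "cmod (p w) = cmod w" for w by (simp add: p_def norm_mult coord_W t)
  \<comment> \<open>For \<open>w = 1\<close> and \<open>x = t \<i>\<close> the right-hand side of
    \<open>Re_eq\<close> is the real part of \<open>- \<i>\<close>, so \<open>p 1\<close> and
    \<open>p \<i>\<close> are orthogonal in the plane. The sign left open by this is the linear or
    antilinear alternative.\<close>
  have "Re (p 1 * (W (t \<i>) $ i * cnj (W (t \<i>) $ j))) = 0"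
    by (simp only: Re_eq t) simp
  moreover have "W (t \<i>) $ i * cnj (W (t \<i>) $ j) = cnj (p \<i>)" by (simp add: p_def)
  ultimately have "Re (p 1 * cnj (p \<i>)) = 0" by metis
  then have pi: "p \<i> = \<i> * p 1 \<or> p \<i> = - \<i> * p 1"
    using unit_orthogonal_complex cmod_p by simp
  have p1: "cnj (p 1) * (p 1 * m) = m" for m
    using cmod_p[of 1] complex_norm_square[of "p 1"] by (simp flip: mult.assoc) (simp add: mult.commute)
  show ?thesis
  proof (intro exI[of _ "cnj (p 1)"] conjI)
    show "cmod (cnj (p 1)) = 1" by (simp add: cmod_p)
    from pi show "(\<forall>x. W x $ i * cnj (W x $ j) = cnj (p 1) * (x $ i * cnj (x $ j))) \<or>
      (\<forall>x. W x $ i * cnj (W x $ j) = cnj (p 1) * cnj (x $ i * cnj (x $ j)))"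
    proof
      assume pi: "p \<i> = \<i> * p 1"
      have "p 1 * (W x $ i * cnj (W x $ j)) = x $ i * cnj (x $ j)" for x
        using Re_eq[of 1 x] Re_eq[of \<i> x] unfolding pi mult.assoc
        by (intro complex_eqI) simp_all
      then show ?thesis by (metis p1)
    next
      assume pi: "p \<i> = - \<i> * p 1"
      have "p 1 * (W x $ i * cnj (W x $ j)) = cnj (x $ i * cnj (x $ j))" for x
        using Re_eq[of 1 x] Re_eq[of \<i> x] unfolding pi mult.assoc
        by (intro complex_eqI) simp_all
      then show ?thesis by (metis p1)
    qed
  qed
qed

text \<open>The pairwise phases and conjugation flags are glued by comparing coordinates through a
  reference coordinate \<open>z\<close>: the phases satisfy a cocycle relation and all flags against
  \<open>z\<close> coincide.\<close>

lemma wigner_coordinates: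
  fixes W :: "complex^'n::finite \<Rightarrow> complex^'n"
  assumes cinner_W: "\<And>x y. cmod (cinner (W x) (W y)) = cmod (cinner x y)"
    and coord_W: "\<And>x i. cmod (W x $ i) = cmod (x $ i)"
  obtains b where "\<And>i. cmod (b i) = 1"
    "(\<forall>x. rank_one (W x) = rank_one (\<chi> i. b i * x $ i)) \<or>
     (\<forall>x. rank_one (W x) = rank_one (\<chi> i. b i * cnj (x $ i)))"
proof -
  define conj_if :: "bool \<Rightarrow> complex \<Rightarrow> complex" where "conj_if s z = (if s then cnj z else z)" for s z
  have conj_if_mult: "conj_if s (z * w) = conj_if s z * conj_if s w" for s z w
    by (simp add: conj_if_def)
  have conj_if_cnj: "conj_if s (cnj z) = cnj (conj_if s z)" for s z
    by (simp add: conj_if_def)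
  have conj_if_1: "conj_if s 1 = 1" for s by (simp add: conj_if_def)
  have "\<exists>a s. cmod a = 1 \<and> (\<forall>x. W x $ i * cnj (W x $ j) = a * conj_if s (x $ i * cnj (x $ j)))" for i j
  proof (cases "i = j")
    case True
    have "W x $ i * cnj (W x $ i) = x $ i * cnj (x $ i)" for x
      by (metis complex_norm_square coord_W)
    then show ?thesis
      using True by (intro exI[of _ 1] exI[of _ False]) (simp add: conj_if_def)
  next
    case False
    from wigner_pair[OF cinner_W coord_W this] show ?thesis
      unfolding conj_if_def by (metis (full_types))
  qed
  then obtain a s where a: "\<And>i j. cmod (a i j) = 1"
    and pair: "\<And>i j x. W x $ i * cnj (W x $ j) = a i j * conj_if (s i j) (x $ i * cnj (x $ j))"
    by metis
  define z :: 'n where "z = undefined"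
  define b where "b i = (if i = z then 1 else a i z)" for i
  \<comment> \<open>The flag of some coordinate other than \<open>z\<close>. If \<open>z\<close> is
    the only index the value is arbitrary, and then only moduli enter.\<close>
  define \<sigma> where "\<sigma> = s (SOME i. i \<noteq> z) z"
  have a_cnj: "a i j * cnj (a i j) = 1" for i j
    using complex_norm_square[of "a i j"] a by simp
  have chain: "(W x $ i * cnj (W x $ z)) * cnj (W x $ j * cnj (W x $ z)) = W x $ i * cnj (W x $ j)"
    if "x $ z = 1" for x i j
  proof -
    have "W x $ z * cnj (W x $ z) = 1"
      using complex_norm_square[of "W x $ z"] by (simp add: coord_W that)
    then show ?thesis by (simp add: algebra_simps)
  qed
  \<comment> \<open>The vector with \<open>u\<close> at \<open>i\<close>, \<open>w\<close> at
    \<open>j\<close> and 1 elsewhere compares the pair directly and through \<open>z\<close>: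
    \<open>u = w = 1\<close> yields the phases, \<open>\<i>\<close> in one slot yields the
    flags.\<close>
  have test: "a i z * conj_if (s i z) u * cnj (a j z * conj_if (s j z) w) = a i j * conj_if (s i j) (u * cnj w)"
    if "i \<noteq> z" "j \<noteq> z" "i \<noteq> j" for i j u w
    using chain[of "\<chi> k. if k = i then u else if k = j then w else 1" i j] that
    unfolding pair by simp
  have a_ij: "a i j = a i z * cnj (a j z)" if "i \<noteq> z" "j \<noteq> z" "i \<noteq> j" for i j
    using test[OF that, of 1 1] by (simp add: conj_if_1)
  have conj_if_i: "conj_if p \<i> = conj_if q \<i> \<longleftrightarrow> p = q" for p q
    by (auto simp: conj_if_def complex_eq_iff)
  have a_nz: "a i j \<noteq> 0" for i j using a[of i j] by auto
  have s_ij: "s i j = s i z" "s i j = s j z" if "i \<noteq> z" "j \<noteq> z" "i \<noteq> j" for i j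
  proof -
    show "s i j = s i z"
      using test[OF that, of \<i> 1] a_ij[OF that] conj_if_i[of "s i j" "s i z"] a_nz
      by (simp add: conj_if_1)
    have "conj_if (s i j) \<i> = conj_if (s j z) \<i>"
      using test[OF that, of 1 "\<i>"] a_ij[OF that] a_nz
      by (simp add: conj_if_1 conj_if_mult conj_if_cnj flip: complex_cnj_i)
    then show "s i j = s j z" using conj_if_i by blast
  qed
  have \<sigma>: "s i z = \<sigma>" if "i \<noteq> z" for i
  proof -
    define k where "k = (SOME i. i \<noteq> z)"
    have "k \<noteq> z" unfolding k_def using that by (rule someI)
    then show ?thesis unfolding \<sigma>_def k_def[symmetric]
      using s_ij[OF that \<open>k \<noteq> z\<close>] by (cases "i = k") auto
  qed
  have b: "cmod (b i) = 1" for i by (simp add: b_def a)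
  have main: "W x $ i * cnj (W x $ j) = (b i * conj_if \<sigma> (x $ i)) * cnj (b j * conj_if \<sigma> (x $ j))" for x i j
  proof -
    consider "i = j" | "i \<noteq> z" "j = z" | "i = z" "j \<noteq> z" | "i \<noteq> z" "j \<noteq> z" "i \<noteq> j" by blast
    then show ?thesis
    proof cases
      case 1
      have "cmod (b i * conj_if \<sigma> (x $ i)) = cmod (W x $ i)"
        by (simp add: norm_mult b coord_W conj_if_def)
      then show ?thesis unfolding 1 by (metis complex_norm_square)
    next
      case 2
      then show ?thesis
        by (simp add: pair \<sigma> b_def conj_if_mult conj_if_cnj)
    next
      case 3
      have "W x $ j * cnj (W x $ i) = (b j * conj_if \<sigma> (x $ j)) * cnj (b i * conj_if \<sigma> (x $ i))"
        using 3 by (simp add: pair \<sigma> b_def conj_if_mult conj_if_cnj)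
      then have "cnj (W x $ j * cnj (W x $ i)) = cnj ((b j * conj_if \<sigma> (x $ j)) * cnj (b i * conj_if \<sigma> (x $ i)))"
        by (rule arg_cong)
      then show ?thesis by (simp add: mult.commute)
    next
      case 4
      then have "s i j = \<sigma>" using s_ij(1) \<sigma> by metis
      then show ?thesis
        using 4 by (simp add: pair a_ij b_def conj_if_mult conj_if_cnj)
    qed
  qed
  have "rank_one (W x) = rank_one (\<chi> i. b i * conj_if \<sigma> (x $ i))" for x
    by (simp add: vec_eq_iff rank_one_def main del: complex_cnj_mult)
  then show ?thesis
    by (intro that[of b, OF b]) (cases \<sigma>, auto simp: conj_if_def)
qed

section \<open>Unitary and antiunitary operators from matrices\<close>

definition conj_vec :: "complex^'n::finite \<Rightarrow> complex^'n" where
  "conj_vec x = (\<chi> i. cnj (x $ i))"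

definition cadj :: "complex^'n::finite^'n \<Rightarrow> complex^'n^'n" where
  "cadj A = (\<chi> i j. cnj (A $ j $ i))"

lemma cinner_matrix_left: "cinner (A *v x) y = cinner x (cadj A *v y)"
proof -
  have "cinner (A *v x) y = (\<Sum>i\<in>UNIV. \<Sum>j\<in>UNIV. cnj (A $ i $ j) * cnj (x $ j) * y $ i)"
    by (simp add: cinner_def matrix_vector_mult_def sum_distrib_right)
  also have "\<dots> = cinner x (cadj A *v y)"
    by (subst sum.swap) (simp add: cinner_def matrix_vector_mult_def cadj_def sum_distrib_left algebra_simps)
  finally show ?thesis .
qed

lemma cinner_isometry:
  assumes "cadj B ** B = mat 1"
  shows "cinner (B *v x) (B *v y) = cinner x y"
  by (simp add: cinner_matrix_left matrix_vector_mul_assoc assms)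

lemma unitary_op_matrix:
  assumes "cadj B ** B = mat 1"
  shows "unitary_op (\<lambda>x. B *v x)"
proof -
  have "B ** cadj B = mat 1" using assms matrix_left_right_inverse by blast
  then have "B *v (cadj B *v y) = y" for y by (simp add: matrix_vector_mul_assoc)
  then have "surj (\<lambda>x. B *v x)" by (metis surjI)
  then show ?thesis
    by (simp add: unitary_op_def cinner_isometry[OF assms] matrix_vector_right_distrib vector_scalar_commute)
qed

lemma antiunitary_op_matrix:
  assumes "cadj B ** B = mat 1"
  shows "antiunitary_op (\<lambda>x. B *v conj_vec x)"
proof -
  have "B ** cadj B = mat 1" using assms matrix_left_right_inverse by blast
  then have "B *v (cadj B *v y) = y" for y by (simp add: matrix_vector_mul_assoc)
  moreover have "conj_vec (conj_vec y) = y" for y :: "complex^'a" by (simp add: conj_vec_def vec_eq_iff)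
  ultimately have "surj (\<lambda>x. B *v conj_vec x)"
    by (intro surjI[of _ "\<lambda>y. conj_vec (cadj B *v y)"]) simp
  moreover have "conj_vec (x + y) = conj_vec x + conj_vec y" "conj_vec (c *s x) = cnj c *s conj_vec x"
    "cinner (conj_vec x) (conj_vec y) = cnj (cinner x y)" for x y :: "complex^'a" and c
    by (simp_all add: conj_vec_def vec_eq_iff cinner_def)
  ultimately show ?thesis
    by (simp add: antiunitary_op_def cinner_isometry[OF assms] matrix_vector_right_distrib vector_scalar_commute)
qed

text \<open>\<open>rank_one (B *v z)\<close> is \<open>B ** rank_one z ** cadj B\<close>, so the
  unknown phase of \<open>z\<close> is harmless under \<open>B\<close>.\<close>

lemma rank_one_matrix_cong:
  fixes B :: "complex^'n::finite^'n"
  assumes "rank_one x = rank_one y"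
  shows "rank_one (B *v x) = rank_one (B *v y)"
proof -
  have "rank_one (B *v z) = B ** rank_one z ** cadj B" for z
    by (simp add: vec_eq_iff rank_one_def cadj_def matrix_vector_mult_def matrix_matrix_mult_def
        sum_distrib_left sum_distrib_right algebra_simps)
  then show ?thesis by (simp add: assms)
qed

context psd_cone_automorphism
begin

text \<open>The images of the standard basis are orthonormal. Rotating them back to the standard
  basis gives a map preserving moduli of coordinates, to which \<open>wigner_coordinates\<close>
  applies; the rotation is then undone.\<close>

theorem wigner: "\<exists>U\<in>EU_set TYPE('n). \<forall>x. \<Phi> (rank_one x) = rank_one (U x)"
proof -
  \<comment> \<open>Row \<open>i\<close> is the conjugate of the image of the \<open>i\<close>-th
    basis vector, so \<open>V\<close> takes overlaps with these images as coordinates.\<close>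
  define V :: "complex^'n^'n" where "V = (\<chi> i j. cnj (vec_image (axis i 1) $ j))"
  define W where "W x = V *v vec_image x" for x
  have "V ** cadj V = mat 1"
  proof -
    have "(V ** cadj V) $ i $ j = mat 1 $ i $ j" for i j
    proof -
      have eq: "(V ** cadj V) $ i $ j = cinner (vec_image (axis i 1)) (vec_image (axis j 1))"
        by (simp add: V_def matrix_matrix_mult_def cinner_def cadj_def)
      show ?thesis
      proof (cases "i = j")
        case True
        then show ?thesis unfolding eq by (simp add: cinner_self norm_vec_image mat_def norm_axis_1)
      next
        case False
        have "cmod (cinner (vec_image (axis i 1)) (vec_image (axis j 1))) = 0"
          using False by (simp add: cmod_cinner_vec_image cinner_axis_left) (simp add: axis_def)
        then show ?thesis using False unfolding eq by (simp add: mat_def)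
      qed
    qed
    then show ?thesis by (simp add: vec_eq_iff)
  qed
  then have V: "cadj V ** V = mat 1" using matrix_left_right_inverse by blast
  have cadj_cadj: "cadj (cadj V) = V" by (simp add: cadj_def vec_eq_iff)
  have "cmod (cinner (W x) (W y)) = cmod (cinner x y)" for x y
    by (simp add: W_def cinner_isometry[OF V] cmod_cinner_vec_image)
  moreover have "cmod (W x $ i) = cmod (x $ i)" for x i
  proof -
    have "W x $ i = cinner (vec_image (axis i 1)) (vec_image x)"
      by (simp add: W_def V_def matrix_vector_mult_def cinner_def)
    then show ?thesis by (simp add: cmod_cinner_vec_image cinner_axis_left)
  qed
  ultimately obtain b where b: "\<And>i. cmod (b i) = 1"
    and cases: "(\<forall>x. rank_one (W x) = rank_one (\<chi> i. b i * x $ i)) \<or>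
      (\<forall>x. rank_one (W x) = rank_one (\<chi> i. b i * cnj (x $ i)))"
    using wigner_coordinates[of W] by blast
  define D :: "complex^'n^'n" where "D = (\<chi> i j. if i = j then b i else 0)"
  have D: "D *v x = (\<chi> i. b i * x $ i)" for x
    by (simp add: D_def matrix_vector_mult_def vec_eq_iff if_distrib[of "\<lambda>z. z * _"] cong: if_cong)
  have "cadj D ** D = mat 1"
  proof -
    have "cnj (b i) * b i = 1" for i
      using b[of i] complex_norm_square[of "b i"] by (simp add: mult.commute)
    then show ?thesis
      by (auto simp: D_def cadj_def matrix_matrix_mult_def mat_def vec_eq_iff
          if_distrib[of cnj] if_distrib[of "\<lambda>z. z * _"] cong: if_cong)
  qed
  then have B: "cadj (cadj V ** D) ** (cadj V ** D) = mat 1"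
  proof -
    have "cadj (cadj V ** D) = cadj D ** V"
      by (simp add: cadj_def matrix_matrix_mult_def vec_eq_iff mult.commute)
    then show ?thesis
      using \<open>V ** cadj V = mat 1\<close> \<open>cadj D ** D = mat 1\<close>
      by (metis matrix_mul_assoc matrix_mul_rid)
  qed
  have image: "\<Phi> (rank_one x) = rank_one (cadj V *v W x)" for x
    by (simp add: rank_one_vec_image W_def matrix_vector_mul_assoc V)
  from cases show ?thesis
  proof
    assume "\<forall>x. rank_one (W x) = rank_one (\<chi> i. b i * x $ i)"
    then have "\<Phi> (rank_one x) = rank_one ((cadj V ** D) *v x)" for x
      unfolding image using rank_one_matrix_cong[of "W x" "D *v x" "cadj V"]
      by (simp add: matrix_vector_mul_assoc[symmetric] D)
    then show ?thesis
      using unitary_op_matrix[OF B] by (auto simp: EU_set_def)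
  next
    assume "\<forall>x. rank_one (W x) = rank_one (\<chi> i. b i * cnj (x $ i))"
    then have "\<Phi> (rank_one x) = rank_one ((cadj V ** D) *v conj_vec x)" for x
      unfolding image using rank_one_matrix_cong[of "W x" "D *v conj_vec x" "cadj V"]
      by (simp add: matrix_vector_mul_assoc[symmetric] D conj_vec_def)
    then show ?thesis
      using antiunitary_op_matrix[OF B]
      by (intro bexI[of _ "\<lambda>x. (cadj V ** D) *v conj_vec x"]) (auto simp: EU_set_def)
  qed
qed

end

section \<open>The action of the extended unitary group\<close>

text \<open>One scalar map \<open>\<sigma>\<close> lets unitary and antiunitary operators be treated
  by the same computation.\<close>

lemma EU_cases:
  assumes "U \<in> EU_set TYPE('n::finite)"
  obtains \<sigma> where "\<sigma> = id \<or> \<sigma> = cnj" "surj U" "\<And>x y. U (x + y) = U x + U y"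
    "\<And>c x. U (c *s x) = \<sigma> c *s U x" "\<And>x y. cinner (U x) (U y) = \<sigma> (cinner x y)"
proof -
  from assms consider "unitary_op U" | "antiunitary_op U" by (auto simp: EU_set_def)
  then show thesis
  proof cases
    case 1
    then show thesis using that[of id] by (simp add: unitary_op_def)
  next
    case 2
    then show thesis using that[of cnj] by (simp add: antiunitary_op_def)
  qed
qed

lemma EU_norm:
  assumes "U \<in> EU_set TYPE('n::finite)"
  shows "norm (U x) = norm x"
proof -
  have "cinner (U x) (U x) = cinner x x"
    by (rule EU_cases[OF assms]) (auto simp: cnj_cinner)
  then have "(norm (U x))\<^sup>2 = (norm x)\<^sup>2" unfolding cinner_self of_real_eq_iff .
  then show ?thesis by simp
qed

lemma EU_bij:
  assumes "U \<in> EU_set TYPE('n::finite)"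
  shows "bij U"
proof (rule EU_cases[OF assms])
  fix \<sigma> assume U: "surj U" "\<And>x y. U (x + y) = U x + U y"
  have "x = y" if "U x = U y" for x y
  proof -
    have "U x = U (x - y) + U y" by (simp flip: U(2))
    then have "norm (x - y) = 0" using that EU_norm[OF assms, of "x - y"] by simp
    then show ?thesis by simp
  qed
  then show ?thesis using U(1) by (simp add: bij_def inj_def)
qed

lemma EU_comp:
  assumes "U \<in> EU_set TYPE('n::finite)" "V \<in> EU_set TYPE('n)"
  shows "U \<circ> V \<in> EU_set TYPE('n)"
proof -
  have "surj (U \<circ> V)"
    using EU_bij[OF assms(1)] EU_bij[OF assms(2)] by (metis bij_comp bij_is_surj)
  then show ?thesis
    using assms unfolding EU_set_def unitary_op_def antiunitary_op_def mem_Collect_eq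
    by (elim disjE) simp_all
qed

lemma EU_inv:
  assumes "U \<in> EU_set TYPE('n::finite)"
  shows "inv_into UNIV U \<in> EU_set TYPE('n)"
proof -
  have bij: "bij U" by (rule EU_bij[OF assms])
  have [simp]: "U (inv_into UNIV U x) = x" "inv_into UNIV U (U x) = x" for x
    using bij by (simp_all add: bij_is_surj surj_f_inv_f bij_is_inj)
  have surj: "surj (inv_into UNIV U)" using bij by (simp add: bij_imp_bij_inv bij_is_surj)
  from assms consider "unitary_op U" | "antiunitary_op U" by (auto simp: EU_set_def)
  then show ?thesis
  proof cases
    case 1
    note U = 1[unfolded unitary_op_def]
    have "inv_into UNIV U (x + y) = inv_into UNIV U x + inv_into UNIV U y" "inv_into UNIV U (c *s x) = c *s inv_into UNIV U x"
      "cinner (inv_into UNIV U x) (inv_into UNIV U y) = cinner x y" for x y c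
      using U by (metis \<open>\<And>x. U (inv_into UNIV U x) = x\<close> \<open>\<And>x. inv_into UNIV U (U x) = x\<close>)+
    then show ?thesis using surj by (simp add: EU_set_def unitary_op_def)
  next
    case 2
    note U = 2[unfolded antiunitary_op_def]
    have "inv_into UNIV U (x + y) = inv_into UNIV U x + inv_into UNIV U y" "inv_into UNIV U (c *s x) = cnj c *s inv_into UNIV U x"
      "cinner (inv_into UNIV U x) (inv_into UNIV U y) = cnj (cinner x y)" for x y c
      using U by (metis \<open>\<And>x. U (inv_into UNIV U x) = x\<close> \<open>\<And>x. inv_into UNIV U (U x) = x\<close> complex_cnj_cnj)+
    then show ?thesis using surj by (simp add: EU_set_def antiunitary_op_def)
  qed
qed

lemma id_EU: "id \<in> EU_set TYPE('n::finite)"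
  by (simp add: EU_set_def unitary_op_def)

lemma group_EU: "group (EU TYPE('n::finite))"
proof (rule groupI)
  fix U :: "complex^'n \<Rightarrow> complex^'n" assume "U \<in> carrier (EU TYPE('n))"
  then have U: "U \<in> EU_set TYPE('n)" by (simp add: EU_def)
  have "inv_into UNIV U \<circ> U = id" using EU_bij[OF U] by (simp add: bij_is_inj)
  then show "\<exists>V\<in>carrier (EU TYPE('n)). V \<otimes>\<^bsub>EU TYPE('n)\<^esub> U = \<one>\<^bsub>EU TYPE('n)\<^esub>"
    using EU_inv[OF U] by (auto simp: EU_def)
qed (auto simp: EU_def EU_comp id_EU comp_assoc)

text \<open>The matrix of \<open>v \<mapsto> U (X (U\<^sup>-\<^sup>1 v))\<close>, a complex linear map also for antiunitary \<open>U\<close>.\<close>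

definition conj_act :: "(complex^'n::finite \<Rightarrow> complex^'n) \<Rightarrow> complex^'n^'n \<Rightarrow> complex^'n^'n" where
  "conj_act U X = (\<chi> i j. U (X *v inv_into UNIV U (axis j 1)) $ i)"

lemma linear_conj_act:
  assumes "U \<in> EU_set TYPE('n::finite)"
  shows "linear (conj_act U)"
proof (rule EU_cases[OF assms])
  fix \<sigma> assume U: "\<sigma> = id \<or> \<sigma> = cnj" "\<And>x y. U (x + y) = U x + U y" "\<And>c x. U (c *s x) = \<sigma> c *s U x"
  have "U (r *\<^sub>R x) = r *\<^sub>R U x" for r x
  proof -
    have scale: "r *\<^sub>R y = of_real r *s y" for y :: "complex^'n"
      by (simp add: vec_eq_iff) (simp add: scaleR_conv_of_real)
    have "\<sigma> (of_real r) = of_real r" using U(1) by auto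
    then show ?thesis unfolding scale by (simp add: U(3))
  qed
  moreover have "(r *\<^sub>R X) *v w = r *\<^sub>R (X *v w)" for r w and X :: "complex^'n^'n"
    by (simp add: matrix_vector_mult_def vec_eq_iff scaleR_sum_right)
  ultimately show ?thesis
    by (intro linearI)
      (simp_all add: conj_act_def vec_eq_iff[of "vec_lambda _"] matrix_vector_mult_add_rdistrib U(2))
qed

text \<open>The \<open>\<sigma>\<close> that arises when \<open>U\<close> passes a scalar is exactly
  what turns \<open>cinner x (inv_into UNIV U v)\<close> into \<open>cinner (U x) v\<close>, so the
  antiunitary case obeys the same formula.\<close>

lemma conj_act_rank_one:
  assumes "U \<in> EU_set TYPE('n::finite)"
  shows "conj_act U (rank_one x) = rank_one (U x)"
proof (rule EU_cases[OF assms])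
  fix \<sigma> assume U: "\<And>c x. U (c *s x) = \<sigma> c *s U x" "\<And>x y. cinner (U x) (U y) = \<sigma> (cinner x y)"
  have "\<sigma> (cinner x (inv_into UNIV U v)) = cinner (U x) v" for v
    using EU_bij[OF assms] by (simp add: bij_is_surj surj_f_inv_f flip: U(2))
  then show ?thesis
    by (simp add: conj_act_def rank_one_mult U(1) vec_eq_iff cinner_axis_right)
      (simp add: rank_one_def mult.commute)
qed

lemma hermitian_conj_act:
  assumes "U \<in> EU_set TYPE('n::finite)" "X \<in> herm_ops"
  shows "conj_act U X \<in> herm_ops"
proof -
  have "conj_act U ` span (range rank_one) = span (conj_act U ` range rank_one)"
    by (rule linear_span_image[OF linear_conj_act[OF assms(1)], symmetric])
  also have "\<dots> \<subseteq> herm_ops"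
    by (rule span_minimal[OF _ subspace_herm_ops])
      (auto simp: conj_act_rank_one[OF assms(1)] herm_ops_def hermitian_rank_one)
  finally show ?thesis using assms(2) herm_ops_subset_span by blast
qed

lemma inner_conj_act:
  assumes U: "U \<in> EU_set TYPE('n::finite)" and "X \<in> herm_ops"
  shows "inner (conj_act U X) (rank_one (U v)) = inner X (rank_one v)"
proof (rule linear_eq_on_herm_ops[OF _ _ _ assms(2)])
  show "linear (\<lambda>X. inner (conj_act U X) (rank_one (U v)))"
    by (rule linearI) (simp_all add: inner_add_left linear_add[OF linear_conj_act[OF U]] linear_cmul[OF linear_conj_act[OF U]])
  show "linear (\<lambda>X. inner X (rank_one v))"
    by (rule linearI) (simp_all add: inner_add_left)
  show "inner (conj_act U (rank_one x)) (rank_one (U v)) = inner (rank_one x) (rank_one v)" for x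
    by (rule EU_cases[OF U]) (auto simp: conj_act_rank_one[OF U] inner_rank_one_rank_one)
qed

lemma trace_conj_act:
  assumes U: "U \<in> EU_set TYPE('n::finite)" and "X \<in> herm_ops"
  shows "inner (mat 1) (conj_act U X) = inner (mat 1) X"
proof (rule linear_eq_on_herm_ops[OF _ _ _ assms(2)])
  show "linear (\<lambda>X. inner (mat 1) (conj_act U X))"
    by (rule linearI) (simp_all add: inner_add_right linear_add[OF linear_conj_act[OF U]] linear_cmul[OF linear_conj_act[OF U]])
  show "linear (\<lambda>X :: complex^'n^'n. inner (mat 1) X)"
    by (rule linearI) (simp_all add: inner_add_right)
  show "inner (mat 1) (conj_act U (rank_one x)) = inner (mat 1) (rank_one x)" for x
    by (simp add: conj_act_rank_one[OF U] inner_mat1_rank_one EU_norm[OF U])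
qed

text \<open>Hermitian operators have real trace, so the complex condition becomes one on the real
  functional \<open>inner (mat 1)\<close>.\<close>

lemma density_ops_iff: "A \<in> density_ops \<longleftrightarrow> psd A \<and> inner (mat 1) A = 1"
proof -
  have "ctrace A = of_real (inner (mat 1) A)" if "hermitian A"
  proof -
    have "A $ i $ i = of_real (Re (A $ i $ i))" for i
      using that[unfolded hermitian_def, rule_format, of i i] by (simp add: complex_eq_iff)
    then have "ctrace A = of_real (\<Sum>i\<in>UNIV. Re (A $ i $ i))"
      unfolding ctrace_def by (metis (no_types, lifting) of_real_sum sum.cong)
    moreover have "inner (mat 1 $ i $ j :: complex) (A $ i $ j) = (if j = i then Re (A $ i $ i) else 0)" for i j
      by (simp add: mat_def inner_complex_def)
    then have "inner (mat 1) A = (\<Sum>i\<in>UNIV. Re (A $ i $ i))"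
      by (simp add: inner_vec_def)
    ultimately show ?thesis by simp
  qed
  then show ?thesis
    by (auto simp: density_ops_def psd_def inner_rank_one)
qed

lemma conj_act_density:
  assumes U: "U \<in> EU_set TYPE('n::finite)" and "X \<in> density_ops"
  shows "conj_act U X \<in> density_ops"
proof -
  have X: "X \<in> herm_ops" "psd X" "inner (mat 1) X = 1"
    using assms(2) by (auto simp: density_ops_iff psd_def herm_ops_def)
  have "0 \<le> inner (conj_act U X) (rank_one v)" for v
  proof -
    obtain w where "v = U w" using EU_bij[OF U] by (metis bij_pointE)
    then show ?thesis using inner_conj_act[OF U X(1)] X(2) by (simp add: psd_def)
  qed
  then show ?thesis
    using hermitian_conj_act[OF U X(1)] trace_conj_act[OF U X(1)] X(3)
    by (simp add: density_ops_iff psd_def herm_ops_def)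
qed

lemma conj_act_comp:
  assumes "U \<in> EU_set TYPE('n::finite)" "V \<in> EU_set TYPE('n)" "X \<in> herm_ops"
  shows "conj_act (U \<circ> V) X = conj_act U (conj_act V X)"
proof (rule linear_eq_on_herm_ops[OF _ _ _ assms(3)])
  show "linear (\<lambda>X. conj_act U (conj_act V X))"
    using linear_compose[OF linear_conj_act[OF assms(2)] linear_conj_act[OF assms(1)]] by (simp add: o_def)
qed (simp_all add: linear_conj_act conj_act_rank_one EU_comp[OF assms(1,2)] assms del: comp_apply, simp)

text \<open>Fixing all rank-one operators fixes all cross terms. Replacing \<open>y\<close> by
  \<open>\<i> *s y\<close> separates their two halves: a unitary \<open>U\<close> is then scalar,
  and an antiunitary \<open>U\<close> would have a one-dimensional range.\<close>

lemma phases_iff_fixes_rank_one: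
  assumes "CARD('n::finite) \<ge> 2" and U: "U \<in> EU_set TYPE('n)"
  shows "U \<in> phases TYPE('n) \<longleftrightarrow> (\<forall>x. rank_one (U x) = rank_one x)"
proof
  assume "U \<in> phases TYPE('n)"
  then show "\<forall>x. rank_one (U x) = rank_one x"
    by (auto simp: phases_def rank_one_scale)
next
  assume fixed: "\<forall>x. rank_one (U x) = rank_one x"
  obtain \<sigma> where \<sigma>: "\<sigma> = id \<or> \<sigma> = cnj" and U': "surj U" "\<And>x y. U (x + y) = U x + U y"
    "\<And>c x. U (c *s x) = \<sigma> c *s U x"
    by (rule EU_cases[OF U]) blast
  have "cross_op (U x) (U y) = cross_op x y" for x y
    using fixed[rule_format, of "x + y"] fixed by (simp add: U'(2) rank_one_add)
  then have polar: "U x $ k * cnj (U y $ l) + U y $ k * cnj (U x $ l) = x $ k * cnj (y $ l) + y $ k * cnj (x $ l)" for x y k l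
    by (simp add: cross_op_def vec_eq_iff)
  \<comment> \<open>The second premise is the polarised identity at \<open>\<i> *s y\<close>; the
    sign on its left side is that of \<open>\<sigma> \<i>\<close>.\<close>
  have eq: "p + q = r + s \<Longrightarrow> - \<i> * p + \<i> * q = - \<i> * r + \<i> * s \<Longrightarrow> p = r"
    "p + q = r + s \<Longrightarrow> \<i> * p - \<i> * q = - \<i> * r + \<i> * s \<Longrightarrow> p = s" for p q r s
    by (auto simp: complex_eq_iff)
  define e :: "complex^'n" where "e = axis undefined 1"
  have norm_Ue: "cinner (U e) (U e) = 1" by (simp add: cinner_self EU_norm[OF U] e_def norm_axis_1)
  from \<sigma> show "U \<in> phases TYPE('n)"
  proof
    assume \<sigma>: "\<sigma> = id"
    have "U x $ k * cnj (U y $ l) = x $ k * cnj (y $ l)" for x y k l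
    proof (rule eq(1)[OF polar[of x k y l]])
      show "- \<i> * (U x $ k * cnj (U y $ l)) + \<i> * (U y $ k * cnj (U x $ l)) =
          - \<i> * (x $ k * cnj (y $ l)) + \<i> * (y $ k * cnj (x $ l))"
        using polar[of x k "\<i> *s y" l] by (simp add: U'(3) \<sigma> algebra_simps)
    qed
    \<comment> \<open>Contracting with the unit vector \<open>U e\<close> makes every
      \<open>U x\<close> the same multiple of \<open>x\<close>.\<close>
    then have "U x $ k * (cnj (U e $ l) * U e $ l) = x $ k * (cnj (e $ l) * U e $ l)" for x k l
      by (simp only: mult.assoc[symmetric])
    then have "(\<Sum>l\<in>UNIV. U x $ k * (cnj (U e $ l) * U e $ l)) = (\<Sum>l\<in>UNIV. x $ k * (cnj (e $ l) * U e $ l))" for x k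
      by (intro sum.cong refl)
    then have "U x $ k * cinner (U e) (U e) = x $ k * cinner e (U e)" for x k
      unfolding cinner_def sum_distrib_left .
    then have Ux: "U x = cinner e (U e) *s x" for x
      by (simp add: norm_Ue vec_eq_iff mult.commute)
    define c where "c = cinner e (U e)"
    have "cnj c * c = 1"
    proof -
      have "U e = c *s e" using Ux[of e] by (simp only: c_def)
      then have "cnj c * (c * cinner e e) = 1"
        using norm_Ue by (simp only: cinner_scale_left cinner_scale_right mult.left_commute)
      then show ?thesis by (simp add: e_def cinner_axis_left)
    qed
    then have "complex_of_real ((cmod c)\<^sup>2) = of_real 1"
      unfolding complex_norm_square by (simp add: mult.commute)
    then have "(cmod c)\<^sup>2 = 1" unfolding of_real_eq_iff .
    then have "cmod c = 1" using abs_square_eq_1[of "cmod c"] by simp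
    then have "c = exp (\<i> * of_real (Arg c))" using Arg_eq[of c] by force
    then have "U = (\<lambda>x. exp (\<i> * of_real (Arg c)) *s x)" using Ux by (metis c_def ext)
    then show ?thesis unfolding phases_def by blast
  next
    assume \<sigma>: "\<sigma> = cnj"
    have "U x $ k * cnj (U y $ l) = y $ k * cnj (x $ l)" for x y k l
    proof (rule eq(2)[OF polar[of x k y l]])
      show "\<i> * (U x $ k * cnj (U y $ l)) - \<i> * (U y $ k * cnj (U x $ l)) =
          - \<i> * (x $ k * cnj (y $ l)) + \<i> * (y $ k * cnj (x $ l))"
        using polar[of x k "\<i> *s y" l] by (simp add: U'(3) \<sigma> algebra_simps)
    qed
    \<comment> \<open>The same contraction now makes every \<open>U x\<close> a multiple of
      \<open>e\<close>, against surjectivity when a second coordinate exists.\<close>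
    then have "U x $ k * (cnj (U e $ l) * U e $ l) = e $ k * (cnj (x $ l) * U e $ l)" for x k l
      by (simp only: mult.assoc[symmetric])
    then have "(\<Sum>l\<in>UNIV. U x $ k * (cnj (U e $ l) * U e $ l)) = (\<Sum>l\<in>UNIV. e $ k * (cnj (x $ l) * U e $ l))" for x k
      by (intro sum.cong refl)
    then have "U x $ k * cinner (U e) (U e) = e $ k * cinner x (U e)" for x k
      unfolding cinner_def sum_distrib_left .
    then have Ux: "U x $ k = e $ k * cinner x (U e)" for x k
      by (simp add: norm_Ue)
    have "(UNIV :: 'n set) \<noteq> {undefined}"
    proof
      assume "(UNIV :: 'n set) = {undefined}"
      then have "CARD('n) = card {undefined :: 'n}" by (rule arg_cong)
      then show False using assms(1) by simp
    qed
    then obtain k :: 'n where k: "k \<noteq> undefined" by blast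
    obtain x where "U x = axis k 1" using U'(1) by (metis surjD)
    then have "axis k 1 $ k = e $ k * cinner x (U e)" using Ux by metis
    then show ?thesis using k by (simp add: e_def axis_def)
  qed
qed

lemma conj_act_id:
  assumes "X \<in> herm_ops"
  shows "conj_act id X = X"
  using linear_eq_on_herm_ops[OF linear_conj_act[OF id_EU] linear_id _ assms]
  by (simp add: conj_act_rank_one[OF id_EU])

section \<open>The positive cone as the cone over the density operators\<close>

lemma mat1_eq_sum_rank_one: "(mat 1 :: complex^'n::finite^'n) = (\<Sum>i\<in>UNIV. rank_one (axis i 1))"
proof -
  have "(\<Sum>k\<in>UNIV. rank_one (axis k 1) :: complex^'n^'n) $ i $ j = mat 1 $ i $ j" for i j
  proof -
    have "rank_one (axis k 1) $ i $ j = (if k = i then if i = j then 1 else 0 else 0 :: complex)" for k :: 'n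
      by (auto simp: rank_one_def axis_def)
    then show ?thesis by (simp add: mat_def)
  qed
  then show ?thesis by (simp add: vec_eq_iff)
qed

text \<open>A nonzero positive operator has a nonzero rank-one summand and hence strictly positive
  trace, by which it can be divided.\<close>

lemma psd_cases:
  fixes A :: "complex^'n::finite^'n"
  assumes "psd A"
  obtains "A = 0" | t \<rho> where "t > 0" "\<rho> \<in> density_ops" "A = t *\<^sub>R \<rho>"
proof (cases "A = 0")
  case False
  define t where "t = inner (mat 1) A"
  have trace_nonneg: "0 \<le> inner (mat 1) C" if "psd C" for C :: "complex^'n^'n"
    using that unfolding mat1_eq_sum_rank_one inner_sum_left psd_def
    by (auto simp: inner_commute intro!: sum_nonneg)
  obtain z C where "z \<noteq> 0" "psd C" "A = rank_one z + C"
    using psd_rank_one_summand[OF assms False] by blast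
  then have "t = (norm z)\<^sup>2 + inner (mat 1) C" by (simp add: t_def inner_add_right inner_mat1_rank_one)
  then have t: "t > 0" using \<open>z \<noteq> 0\<close> trace_nonneg[OF \<open>psd C\<close>] by (simp add: add_pos_nonneg)
  have "A \<in> herm_ops" using assms by (simp add: psd_def herm_ops_def)
  then have "(1 / t) *\<^sub>R A \<in> herm_ops" by (rule subspace_scale[OF subspace_herm_ops])
  then have "(1 / t) *\<^sub>R A \<in> density_ops"
    using t assms by (simp add: density_ops_iff psd_def herm_ops_def) (simp add: t_def)
  then show ?thesis using that(2)[of t "(1 / t) *\<^sub>R A"] t by simp
qed (use that in blast)

lemma density_herm: "\<rho> \<in> density_ops \<Longrightarrow> \<rho> \<in> herm_ops"
  by (simp add: density_ops_def herm_ops_def)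

lemma psd_cone_automorphism_of_density:
  fixes \<Phi> \<Psi> :: "complex^'n::finite^'n \<Rightarrow> complex^'n^'n"
  assumes lin: "linear \<Phi>" "linear \<Psi>"
    and dens: "\<And>\<rho>. \<rho> \<in> density_ops \<Longrightarrow> \<Phi> \<rho> \<in> density_ops" "\<And>\<rho>. \<rho> \<in> density_ops \<Longrightarrow> \<Psi> \<rho> \<in> density_ops"
    and inv: "\<And>\<rho>. \<rho> \<in> density_ops \<Longrightarrow> \<Psi> (\<Phi> \<rho>) = \<rho>" "\<And>\<rho>. \<rho> \<in> density_ops \<Longrightarrow> \<Phi> (\<Psi> \<rho>) = \<rho>"
  shows "psd_cone_automorphism \<Phi> \<Psi>"
proof -
  have psd_scale: "psd (t *\<^sub>R \<rho>)" if "t > 0" "\<rho> \<in> density_ops" for t and \<rho> :: "complex^'n^'n"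
    using that subspace_scale[OF subspace_herm_ops, of \<rho> t]
    by (simp add: density_ops_iff psd_def herm_ops_def)
  have psd_0: "psd 0" by (simp add: psd_def hermitian_def)
  note \<Phi> = linear_cmul[OF lin(1)] linear_0[OF lin(1)] and \<Psi> = linear_cmul[OF lin(2)] linear_0[OF lin(2)]
  show ?thesis
  proof
    fix A :: "complex^'n^'n" assume A: "psd A"
    show "psd (\<Phi> A)"
      using A by (cases rule: psd_cases) (simp_all add: \<Phi> psd_0 psd_scale dens)
    show "psd (\<Psi> A)"
      using A by (cases rule: psd_cases) (simp_all add: \<Psi> psd_0 psd_scale dens)
    show "\<Psi> (\<Phi> A) = A"
      using A by (cases rule: psd_cases) (simp_all add: \<Phi> \<Psi> inv)
    show "\<Phi> (\<Psi> A) = A"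
      using A by (cases rule: psd_cases) (simp_all add: \<Phi> \<Psi> inv)
    show "inner (mat 1) (\<Phi> A) = inner (mat 1) A"
      using A
    proof (cases rule: psd_cases)
      case (2 t \<rho>)
      then show ?thesis using dens(1)[of \<rho>] by (simp add: \<Phi> density_ops_iff)
    qed (simp add: \<Phi>)
  qed (simp_all add: linear_add[OF lin(1)] linear_add[OF lin(2)] \<Phi> \<Psi>)
qed

section \<open>The preservation group\<close>

text \<open>Since the entries of \<open>q\<close> sum to 1, the constant term of the affine map can
  be multiplied by that sum, which makes the map linear.\<close>

lemma meas_apply_eq_stretched:
  assumes "q \<in> qhyp"
  shows "meas_apply r q = stretched r *v q"
proof -
  let ?d = "real CARD('a)"
  have q: "(\<Sum>j\<in>UNIV. q $ j) = 1" using assms by (simp add: qhyp_def)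
  have "(\<Sum>j\<in>UNIV. ((?d + 1) * q $ j - 1 / ?d) * r $ i $ j) =
      (\<Sum>j\<in>UNIV. ((?d + 1) * r $ i $ j - 1 / ?d * (\<Sum>k\<in>UNIV. r $ i $ k)) * q $ j)" for i
  proof -
    have "(\<Sum>j\<in>UNIV. ((?d + 1) * r $ i $ j - 1 / ?d * (\<Sum>k\<in>UNIV. r $ i $ k)) * q $ j) =
        (\<Sum>j\<in>UNIV. (?d + 1) * r $ i $ j * q $ j) - 1 / ?d * (\<Sum>k\<in>UNIV. r $ i $ k) * (\<Sum>j\<in>UNIV. q $ j)"
      by (simp only: left_diff_distrib sum_subtractf sum_distrib_left)
    also have "\<dots> = (\<Sum>j\<in>UNIV. (?d + 1) * r $ i $ j * q $ j) - (\<Sum>k\<in>UNIV. 1 / ?d * r $ i $ k)"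
      by (simp only: q mult_1_right sum_distrib_left)
    also have "\<dots> = (\<Sum>j\<in>UNIV. ((?d + 1) * q $ j - 1 / ?d) * r $ i $ j)"
      by (simp only: left_diff_distrib sum_subtractf mult.assoc mult.commute[of "r $ _ $ _"])
    finally show ?thesis by simp
  qed
  then show ?thesis
    by (simp add: meas_apply_def stretched_def matrix_vector_mult_def vec_eq_iff)
qed

text \<open>Pairing this vector with \<open>q\<close> gives
  \<open>(q $ j + 1 / d) / (d + 1)\<close>, where \<open>q $ j\<close> is nonnegative; so it lies in
  the polar, which is \<open>Q\<close>.\<close>

lemma basis_distribution_in_qplex:
  fixes Q :: "(real^('n::finite \<times> 'n)) set"
  assumes "qplex Q"
  shows "(1 / (dim TYPE('n) + 1)) *\<^sub>R (axis j 1 + (\<chi> i. 1 / dim TYPE('n))) \<in> Q"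
proof -
  let ?d = "real CARD('n)"
  let ?p = "(1 / (?d + 1)) *\<^sub>R (axis j 1 + (\<chi> i. 1 / ?d))"
  have d: "?d > 0" by simp
  have "?p \<in> polar Q"
    unfolding polar_def
  proof safe
    have "(\<Sum>i\<in>UNIV. axis j (1::real) $ i) = 1" by (simp add: axis_def)
    then have "(\<Sum>i\<in>UNIV. ?p $ i) = 1 / (?d + 1) * (1 + ?d * ?d / ?d)"
      by (simp add: sum.distrib card_cartesian_product flip: sum_divide_distrib)
    also have "\<dots> = 1" using d by (simp add: field_simps)
    finally show "?p \<in> qhyp" by (simp add: qhyp_def)
  next
    fix q assume "q \<in> Q"
    then have q: "0 \<le> q $ j" "(\<Sum>i\<in>UNIV. q $ i) = 1"
      using assms unfolding qplex_def prob_simplex_def by blast+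
    have "inner (\<chi> i. 1 / ?d) q = 1 / ?d" using q(2) by (simp add: inner_vec_def flip: sum_divide_distrib)
    moreover have "inner (axis j 1) q = q $ j" by (simp add: inner_axis')
    ultimately have "inner ?p q = (q $ j + 1 / ?d) / (?d + 1)" by (simp add: inner_add_left)
    moreover have "1 / (?d * (?d + 1)) = (1 / ?d) / (?d + 1)" by simp
    ultimately show "1 / (?d * (?d + 1)) \<le> inner ?p q"
      using q(1) by (simp only:) (rule divide_right_mono, simp_all)
  qed
  then show ?thesis using assms by (simp add: qplex_def)
qed

text \<open>For a linear bijection of \<open>Q\<close> the associated measurement has the images of the basis
  distributions as columns, so its nonnegativity and normalisation come for free.\<close>

lemma pres_set_eq:
  fixes Q :: "(real^('n::finite \<times> 'n)) set"
  assumes Q: "qplex Q"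
  shows "pres_set Q = {R. (\<lambda>q. R *v q) ` Q = Q}"
proof (intro equalityI subsetI)
  have hyp: "Q \<subseteq> qhyp" using Q by (auto simp: qplex_def prob_simplex_def qhyp_def)
  fix R assume "R \<in> pres_set Q"
  then obtain r where "R = stretched r" "meas_apply r ` Q = Q"
    by (auto simp: pres_set_def preserving_def)
  moreover have "meas_apply r ` Q = (\<lambda>q. stretched r *v q) ` Q"
    using hyp by (intro image_cong) (auto simp: meas_apply_eq_stretched)
  ultimately show "R \<in> {R. (\<lambda>q. R *v q) ` Q = Q}" by simp
next
  let ?d = "real CARD('n)"
  have d: "?d > 0" by simp
  have hyp: "Q \<subseteq> qhyp" using Q by (auto simp: qplex_def prob_simplex_def qhyp_def)
  fix R :: "real^('n \<times> 'n)^('n \<times> 'n)" assume "R \<in> {R. (\<lambda>q. R *v q) ` Q = Q}"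
  then have R: "(\<lambda>q. R *v q) ` Q = Q" by simp
  \<comment> \<open>Chosen so that the coefficients \<open>(d + 1) * p j $ k - 1 / d\<close> in
    \<open>meas_apply\<close> form the basis vector \<open>axis j 1\<close>.\<close>
  define p where "p j = (1 / (?d + 1)) *\<^sub>R (axis j 1 + (\<chi> i. 1 / ?d) :: real^('n \<times> 'n))" for j
  define r :: "real^('n \<times> 'n)^('n \<times> 'n)" where "r = (\<chi> i j. (R *v p j) $ i)"
  have "R *v p j \<in> prob_simplex" for j
    using basis_distribution_in_qplex[OF Q, of j] R Q unfolding p_def qplex_def by blast
  then have "measurement r" by (simp add: measurement_def r_def prob_simplex_def)
  moreover have str: "stretched r = R"
  proof -
    have r: "r $ i $ j = (R $ i $ j + (\<Sum>k\<in>UNIV. R $ i $ k) / ?d) / (?d + 1)" for i j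
    proof -
      have "R *v axis j 1 = column j R" by (simp add: matrix_vector_mult_basis)
      then have "R *v p j = (1 / (?d + 1)) *\<^sub>R (column j R + R *v (\<chi> i. 1 / ?d))"
        by (simp add: p_def matrix_vector_mult_scaleR matrix_vector_right_distrib)
      then have "(R *v p j) $ i = (R $ i $ j + (R *v (\<chi> i. 1 / ?d)) $ i) / (?d + 1)"
        by (simp add: column_def)
      also have "(R *v (\<chi> i. 1 / ?d)) $ i = (\<Sum>k\<in>UNIV. R $ i $ k) / ?d"
        by (simp add: matrix_vector_mult_def sum_divide_distrib)
      finally show ?thesis by (simp add: r_def)
    qed
    \<comment> \<open>With \<open>d^2\<close> columns the averaging adds \<open>d\<close> times the
      row sum of \<open>R\<close>, and division by \<open>d + 1\<close> restores it; equal row sums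
      make \<open>stretched\<close> invert the construction.\<close>
    have "(\<Sum>k\<in>UNIV. r $ i $ k) = (\<Sum>k\<in>UNIV. R $ i $ k)" for i
    proof -
      have "(\<Sum>k\<in>UNIV. r $ i $ k) = ((\<Sum>k\<in>UNIV. R $ i $ k) + ?d * ?d * ((\<Sum>k\<in>UNIV. R $ i $ k) / ?d)) / (?d + 1)"
        by (simp add: r sum.distrib card_cartesian_product flip: sum_divide_distrib)
      also have "\<dots> = (\<Sum>k\<in>UNIV. R $ i $ k)" using d by (simp add: field_simps)
      finally show ?thesis .
    qed
    then have "stretched r $ i $ j = R $ i $ j" for i j
      using d by (simp add: stretched_def r)
    then show ?thesis by (simp add: vec_eq_iff)
  qed
  moreover have "meas_apply r ` Q = (\<lambda>q. R *v q) ` Q"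
    using hyp by (intro image_cong) (auto simp: meas_apply_eq_stretched str)
  ultimately show "R \<in> pres_set Q" using R by (auto simp: pres_set_def preserving_def)
qed

section \<open>The homomorphism from extended unitaries onto the preservation group\<close>

lemma phases_subset_EU: "phases TYPE('n::finite) \<subseteq> EU_set TYPE('n)"
proof
  fix U assume "U \<in> phases TYPE('n)"
  then obtain \<theta> where U: "U = (\<lambda>x. exp (\<i> * complex_of_real \<theta>) *s x)" by (auto simp: phases_def)
  define c where "c = exp (\<i> * complex_of_real \<theta>)"
  have "cmod c = 1" by (simp add: c_def)
  then have c: "cnj c * c = 1" using complex_norm_square[of c] by (simp add: mult.commute)
  have "surj U" unfolding U c_def[symmetric]
    by (rule surjI[of _ "\<lambda>x. cnj c *s x"]) (simp add: vector_smult_assoc mult.commute[of c] c)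
  moreover have "cinner (c *s x) (c *s y) = cinner x y" for x y :: "complex^'n"
    by (simp only: cinner_scale_left cinner_scale_right mult.assoc[symmetric] mult.commute[of c] c mult_1_left)
  ultimately show "U \<in> EU_set TYPE('n)"
    by (simp add: EU_set_def unitary_op_def U c_def[symmetric] vector_add_ldistrib vector_smult_assoc mult.commute)
qed

text \<open>\<open>h U\<close> is the matrix of \<open>conj_act U\<close> transported along
  \<open>f\<close>; \<open>wigner\<close> makes \<open>h\<close> surjective and
  \<open>phases_iff_fixes_rank_one\<close> gives its kernel.\<close>

lemma pres_set_hilbert_qplex:
  fixes Q :: "(real^('n::finite \<times> 'n)) set"
  assumes "CARD('n) \<ge> 2" "hilbert_qplex Q"
  obtains h :: "(complex^'n \<Rightarrow> complex^'n) \<Rightarrow> real^('n \<times> 'n)^('n \<times> 'n)" where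
    "h ` EU_set TYPE('n) = pres_set Q" "h id = mat 1"
    "\<And>U V. U \<in> EU_set TYPE('n) \<Longrightarrow> V \<in> EU_set TYPE('n) \<Longrightarrow> h (U \<circ> V) = h U ** h V"
    "\<And>U. U \<in> EU_set TYPE('n) \<Longrightarrow> h U = mat 1 \<longleftrightarrow> U \<in> phases TYPE('n)"
proof -
  obtain f :: "complex^'n^'n \<Rightarrow> real^('n \<times> 'n)" where Q: "qplex Q"
    and f_lin: "\<And>a b X Y. X \<in> herm_ops \<Longrightarrow> Y \<in> herm_ops \<Longrightarrow> f (a *\<^sub>R X + b *\<^sub>R Y) = a *\<^sub>R f X + b *\<^sub>R f Y"
    and f_bij: "bij_betw f herm_ops UNIV" and f_Q: "f ` density_ops = Q"
    using assms(2) unfolding hilbert_qplex_def by blast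
  \<comment> \<open>The map \<open>f\<close> is controlled on Hermitian operators only; composing it
    with the Hermitian part gives a map linear on all matrices.\<close>
  define H :: "complex^'n^'n \<Rightarrow> complex^'n^'n" where "H X = (1/2) *\<^sub>R (X + cadj X)" for X
  have H_lin: "H (X + Y) = H X + H Y" "H (c *\<^sub>R X) = c *\<^sub>R H X" for X Y c
    by (simp_all add: H_def cadj_def vec_eq_iff) (simp_all add: scaleR_conv_of_real algebra_simps)
  have H_herm: "H X \<in> herm_ops" for X
    unfolding herm_ops_def hermitian_def mem_Collect_eq
    by (intro allI) (simp add: H_def cadj_def complex_eq_iff)
  have H_id: "H X = X" if "X \<in> herm_ops" for X
  proof -
    have "cnj (X $ j $ i) = X $ i $ j" for i j
      using that[unfolded herm_ops_def hermitian_def mem_Collect_eq, rule_format, of i j] by simp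
    then have "cadj X = X" by (simp add: cadj_def vec_eq_iff)
    then show ?thesis by (simp add: H_def flip: scaleR_2)
  qed
  define F where "F X = f (H X)" for X
  have F_lin: "linear F"
    using f_lin[OF H_herm H_herm, of 1 _ 1] f_lin[OF H_herm H_herm, of _ _ 0]
    by (intro linearI) (simp_all add: F_def H_lin)
  have F_f: "F X = f X" if "X \<in> herm_ops" for X by (simp add: F_def H_id that)
  define g where "g = inv_into herm_ops f"
  have g_herm: "g v \<in> herm_ops" for v
    unfolding g_def using f_bij by (metis bij_betw_imp_surj_on inv_into_into UNIV_I)
  have Fg: "F (g v) = v" for v
    unfolding F_f[OF g_herm] unfolding g_def using f_bij by (metis bij_betw_inv_into_right UNIV_I)
  have gF: "g (F X) = X" if "X \<in> herm_ops" for X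
    unfolding F_f[OF that] g_def using f_bij that by (rule bij_betw_inv_into_left)
  have g_lin: "linear g"
  proof (rule linearI)
    fix v w :: "real^('n \<times> 'n)" and c :: real
    have "g v + g w \<in> herm_ops" "c *\<^sub>R g v \<in> herm_ops"
      using g_herm subspace_add[OF subspace_herm_ops] subspace_scale[OF subspace_herm_ops] by blast+
    then have "g (F (g v + g w)) = g v + g w" "g (F (c *\<^sub>R g v)) = c *\<^sub>R g v"
      by (simp_all add: gF)
    then show "g (v + w) = g v + g w" "g (c *\<^sub>R v) = c *\<^sub>R g v"
      by (simp_all add: linear_add[OF F_lin] linear_cmul[OF F_lin] Fg)
  qed
  have F_Q: "F \<rho> \<in> Q" if "\<rho> \<in> density_ops" for \<rho>
    using that f_Q F_f[OF density_herm[OF that]] by blast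
  have g_Q: "g q \<in> density_ops" if "q \<in> Q" for q
    using that f_Q gF F_f density_herm by (metis (no_types, lifting) imageE)

  define h where "h U = matrix (\<lambda>v. F (conj_act U (g v)))" for U
  have h: "h U *v v = F (conj_act U (g v))" if "U \<in> EU_set TYPE('n)" for U v
  proof -
    have "linear (F \<circ> (conj_act U \<circ> g))"
      by (intro linear_compose g_lin linear_conj_act[OF that] F_lin)
    then have "linear (\<lambda>v. F (conj_act U (g v)))" by (simp add: o_def)
    then show ?thesis unfolding h_def by (rule fun_cong[OF matrix_vector_mul(2)])
  qed
  have h_comp: "h (U \<circ> V) = h U ** h V" if U: "U \<in> EU_set TYPE('n)" and V: "V \<in> EU_set TYPE('n)" for U V
  proof -
    have "h (U \<circ> V) *v v = (h U ** h V) *v v" for v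
      by (simp add: h[OF EU_comp[OF U V]] h[OF U] h[OF V] conj_act_comp[OF U V g_herm]
          gF[OF hermitian_conj_act[OF V g_herm]] flip: matrix_vector_mul_assoc)
    then show ?thesis by (simp add: matrix_eq)
  qed
  have h_id: "h id = mat 1"
    by (simp add: matrix_eq h[OF id_EU] conj_act_id[OF g_herm] Fg)
  have h_into: "h U *v q \<in> Q" if "U \<in> EU_set TYPE('n)" "q \<in> Q" for U q
    by (simp add: h[OF that(1)] F_Q conj_act_density[OF that(1)] g_Q that(2))
  have "h ` EU_set TYPE('n) = pres_set Q"
  proof (intro equalityI subsetI)
    fix R assume "R \<in> h ` EU_set TYPE('n)"
    then obtain U where U: "U \<in> EU_set TYPE('n)" and R: "R = h U" by blast
    \<comment> \<open>Each \<open>q\<close> in \<open>Q\<close> is the image under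
      \<open>h U\<close> of \<open>h (inv_into UNIV U) *v q\<close>, again in \<open>Q\<close>; this
      gives equality rather than inclusion.\<close>
    have "U \<circ> inv_into UNIV U = id" using EU_bij[OF U] using surj_iff bij_is_surj by blast
    then have "h U ** h (inv_into UNIV U) = mat 1"
      using h_comp[OF U EU_inv[OF U]] h_id by simp
    then have "h U *v (h (inv_into UNIV U) *v q) = q" for q by (simp add: matrix_vector_mul_assoc)
    then have "(\<lambda>q. R *v q) ` Q = Q"
      unfolding R using h_into[OF U] h_into[OF EU_inv[OF U]] by (auto simp: image_iff) metis
    then show "R \<in> pres_set Q" by (simp add: pres_set_eq[OF Q])
  next
    fix R assume "R \<in> pres_set Q"
    then have R: "(\<lambda>q. R *v q) ` Q = Q" by (simp add: pres_set_eq[OF Q])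
    \<comment> \<open>Invertibility of \<open>R\<close>: its range contains \<open>Q\<close>, hence
      all \<open>F (rank_one x)\<close> by scaling, and these span the space.\<close>
    have "F (rank_one x) \<in> range (\<lambda>v. R *v v)" for x
    proof (cases rule: psd_cases[OF psd_rank_one[of x]])
      case 1
      then show ?thesis by (metis linear_0[OF F_lin] matrix_vector_mult_0_right rangeI)
    next
      case (2 t \<rho>)
      obtain q where "F \<rho> = R *v q" using R F_Q[OF 2(2)] by blast
      then have "F (rank_one x) = R *v (t *\<^sub>R q)"
        by (simp add: 2(3) linear_cmul[OF F_lin] matrix_vector_mult_scaleR)
      then show ?thesis by blast
    qed
    then have "F ` span (range rank_one) \<subseteq> range (\<lambda>v. R *v v)"
      unfolding linear_span_image[OF F_lin, symmetric]
      by (intro span_minimal linear_subspace_image subspace_UNIV) auto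
    then have "surj (\<lambda>v. R *v v)"
      using Fg g_herm herm_ops_subset_span by (metis (no_types, opaque_lifting) UNIV_I UNIV_eq_I image_subset_iff subsetD)
    then obtain R' where RR': "R ** R' = mat 1" by (metis matrix_right_invertible_surjective)
    then have R'R: "R' ** R = mat 1" using matrix_left_right_inverse by blast
    have R'_Q: "R' *v q \<in> Q" if q: "q \<in> Q" for q
    proof -
      obtain p where "p \<in> Q" "q = R *v p" using R q by blast
      then show ?thesis by (simp add: matrix_vector_mul_assoc R'R)
    qed
    have R_Q: "R *v q \<in> Q" if "q \<in> Q" for q using R that by blast
    have lin: "linear (\<lambda>X. g (A *v F X))" for A :: "real^('n \<times> 'n)^('n \<times> 'n)"
      by (intro linearI) (simp_all add: linear_add[OF F_lin] linear_cmul[OF F_lin] linear_add[OF g_lin]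
          linear_cmul[OF g_lin] matrix_vector_right_distrib matrix_vector_mult_scaleR)
    interpret psd_cone_automorphism "\<lambda>X. g (R *v F X)" "\<lambda>X. g (R' *v F X)"
    proof (rule psd_cone_automorphism_of_density[OF lin lin])
      fix \<rho> :: "complex^'n^'n" assume \<rho>: "\<rho> \<in> density_ops"
      show "g (R *v F \<rho>) \<in> density_ops" "g (R' *v F \<rho>) \<in> density_ops"
        by (intro g_Q R_Q R'_Q F_Q \<rho>)+
      show "g (R' *v F (g (R *v F \<rho>))) = \<rho>" "g (R *v F (g (R' *v F \<rho>))) = \<rho>"
        by (simp_all add: Fg matrix_vector_mul_assoc RR' R'R gF density_herm[OF \<rho>])
    qed
    obtain U where U: "U \<in> EU_set TYPE('n)" and R_U: "\<And>x. g (R *v F (rank_one x)) = rank_one (U x)"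
      using wigner by blast
    have "conj_act U X = g (R *v F X)" if "X \<in> herm_ops" for X
      by (rule linear_eq_on_herm_ops[OF linear_conj_act[OF U] lin _ that])
        (simp add: conj_act_rank_one[OF U] R_U)
    then have "h U *v v = R *v v" for v
      by (simp add: h[OF U] g_herm Fg)
    then have "h U = R" by (simp add: matrix_eq)
    then show "R \<in> h ` EU_set TYPE('n)" using U by blast
  qed
  moreover have "h U = mat 1 \<longleftrightarrow> U \<in> phases TYPE('n)" if U: "U \<in> EU_set TYPE('n)" for U
  proof -
    have "h U = mat 1 \<longleftrightarrow> (\<forall>v. F (conj_act U (g v)) = v)"
      by (simp add: matrix_eq h[OF U])
    also have "\<dots> \<longleftrightarrow> (\<forall>X\<in>herm_ops. conj_act U X = X)"
      using gF Fg g_herm hermitian_conj_act[OF U] by metis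
    also have "\<dots> \<longleftrightarrow> (\<forall>x. rank_one (U x) = rank_one x)"
    proof
      assume "\<forall>X\<in>herm_ops. conj_act U X = X"
      then show "\<forall>x. rank_one (U x) = rank_one x"
        by (simp add: herm_ops_def hermitian_rank_one flip: conj_act_rank_one[OF U])
    next
      assume "\<forall>x. rank_one (U x) = rank_one x"
      then show "\<forall>X\<in>herm_ops. conj_act U X = X"
        using linear_eq_on_herm_ops[OF linear_conj_act[OF U] linear_id]
        by (simp add: conj_act_rank_one[OF U])
    qed
    finally show ?thesis using phases_iff_fixes_rank_one[OF assms(1) U] by simp
  qed
  ultimately show ?thesis using that[of h] h_comp h_id by blast
qed

theorem mainTheorem18:
  fixes Q :: "(real^('n::finite \<times> 'n)) set"
  assumes "CARD('n) \<ge> 2"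
    and "hilbert_qplex Q"
  shows "group (pres_group Q) \<and> pres_group Q \<cong> PEU TYPE('n)"
proof -
  obtain h :: "(complex^'n \<Rightarrow> complex^'n) \<Rightarrow> real^('n \<times> 'n)^('n \<times> 'n)" where
    img: "h ` EU_set TYPE('n) = pres_set Q" and h_id: "h id = mat 1" and
    mult: "\<And>U V. U \<in> EU_set TYPE('n) \<Longrightarrow> V \<in> EU_set TYPE('n) \<Longrightarrow> h (U \<circ> V) = h U ** h V" and
    ker: "\<And>U. U \<in> EU_set TYPE('n) \<Longrightarrow> h U = mat 1 \<longleftrightarrow> U \<in> phases TYPE('n)"
    using pres_set_hilbert_qplex[OF assms] by blast
  interpret EU: group "EU TYPE('n)" by (rule group_EU)
  have hom: "h \<in> hom (EU TYPE('n)) (pres_group Q)"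
    using img mult by (auto simp: hom_def EU_def pres_group_def)
  \<comment> \<open>The image of \<open>h\<close> with its unit is all of
    \<open>pres_group Q\<close>, which therefore inherits the group axioms.\<close>
  have "(pres_group Q)\<lparr>carrier := h ` carrier (EU TYPE('n)), one := h \<one>\<^bsub>EU TYPE('n)\<^esub>\<rparr> = pres_group Q"
    by (simp add: pres_group_def EU_def img h_id)
  then have grp: "group (pres_group Q)" using EU.hom_imp_img_group[OF hom] by simp
  interpret group_hom "EU TYPE('n)" "pres_group Q" h
    using hom grp EU.group_axioms by (simp add: group_hom_def group_hom_axioms_def)
  have "kernel (EU TYPE('n)) (pres_group Q) h = phases TYPE('n)"
    using ker phases_subset_EU by (auto simp: kernel_def EU_def pres_group_def)
  \<comment> \<open>First isomorphism theorem for the surjective homomorphism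
    \<open>h\<close>.\<close>
  moreover have "EU TYPE('n) Mod kernel (EU TYPE('n)) (pres_group Q) h \<cong> pres_group Q"
    using img by (intro FactGroup_iso) (simp add: EU_def pres_group_def)
  ultimately have "PEU TYPE('n) \<cong> pres_group Q" and "group (PEU TYPE('n))"
    using normal.factorgroup_is_group[OF normal_kernel] by (simp_all add: PEU_def)
  then show ?thesis using grp group.iso_sym by blast
qed

end
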